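(* Let $\alpha\ge 2$, let $N_\alpha$ be the confluent hypergeometric function ${}_1F_1\left(-\frac{\alpha}{2},\frac12,\frac{x^2}{2}\right)$, and let $c_\alpha$ be its smallest positive zero. Define $$u_\alpha(x)=\begin{cases}-\dfrac{\alpha c_\alpha^{\alpha-1}}{N_\alpha'(c_\alpha)}\,N_\alpha(x), & 0\le |x|\le c_\alpha,\\[6pt] c_\alpha^\alpha-|x|^\alpha, & |x|\ge c_\alpha,\end{cases}\qquad U(p,q)=\begin{cases}|q|^\alpha u_\alpha\left(\dfrac{|p|}{|q|}\right), & q\ne 0,\\[6pt] -|p|^\alpha, & q=0,\end{cases}$$ for $(p,q)\in\mathbb{R}^2$, and $$\mathbf{U}(p,q)=\sup\left\{\left\langle c_\alpha^\alpha\big(q^2+(Sf)^2\big)^{\alpha/2}-|f|^\alpha\right\rangle_I \;:\; f\in\mathcal{T}(I),\ \langle f\rangle_I=p\right\},$$ where $Sf$ is the dyadic square function of $f$ on the interval $I$. Then $\mathbf{U}(p,q)=U(p,q)$ for all $(p,q)\in\mathbb{R}^2$.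
   Context: $I$ is a bounded interval. $\mathcal{D}(I)$ is the family of dyadic subintervals of $I$ (including $I$), and $\mathcal{D}_N(I)$ is the subfamily of those of length $2^{-N}|I|$. $\langle f\rangle_I=\frac1{|I|}\int_I f\,dx$. For $J\in\mathcal{D}(I)$, $h_J$ is the Haar function supported on $J$, normalized in $L^2$ (equal to $\pm|J|^{-1/2}$ on the two dyadic halves of $J$), and $\Delta_J f=(f,h_J)h_J$. The class $\mathcal{T}(I)$ of test functions consists of real functions $f$ on $I$ that are constant on each interval of $\mathcal{D}_N(I)$ for some finite $N$. The dyadic square function is $$Sf(x)=\Big(\sum_{J\in\mathcal{D}(I),\,x\in J}(\Delta_J f)^2(x)\Big)^{1/2}.$$ (The average $\langle f\rangle_I$ does not enter $Sf$.) The function $N_\alpha$ is given by $$N_\alpha(x)=\sum_{m=0}^\infty\frac{(-2x^2)^m}{(2m)!}\,\frac{\alpha}{2}\left(\frac{\alpha}{2}-1\right)\cdots\left(\frac{\alpha}{2}-m+1\right),$$ and it satisfies $N_\alpha''-xN_\alpha'+\alpha N_\alpha=0$, $N_\alpha(0)=1$, $N_\alpha'(0)=0$. *)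

theory Defs
  imports "HOL-Analysis.Analysis"
begin

section \<open>Dyadic intervals and test functions\<close>

definition midpt :: "real set \<Rightarrow> real" where
  "midpt J = (Inf J + Sup J) / 2"

text \<open>The midpoint is assigned to the right half, so that the halves partition the interval,
  whichever of its end points the interval contains.\<close>

definition left_half :: "real set \<Rightarrow> real set" where
  "left_half J = {x \<in> J. x < midpt J}"

definition right_half :: "real set \<Rightarrow> real set" where
  "right_half J = {x \<in> J. midpt J \<le> x}"

primrec dyadic_gen :: "nat \<Rightarrow> real set \<Rightarrow> real set set" where
  "dyadic_gen 0 I = {I}"
| "dyadic_gen (Suc N) I = left_half ` dyadic_gen N I \<union> right_half ` dyadic_gen N I"

definition dyadic :: "real set \<Rightarrow> real set set" where
  "dyadic I = (\<Union>N. dyadic_gen N I)"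

text \<open>A function on \<open>I\<close> is represented by a total function whose values outside \<open>I\<close> are
  irrelevant to all the notions below.\<close>

definition test_functions :: "real set \<Rightarrow> (real \<Rightarrow> real) set" where
  "test_functions I = {f. \<exists>N. \<forall>J\<in>dyadic_gen N I. f constant_on J}"

definition average :: "real set \<Rightarrow> (real \<Rightarrow> real) \<Rightarrow> real" where
  "average I f = (LINT x:I|lborel. f x) / measure lborel I"

section \<open>Haar functions and the dyadic square function\<close>

definition haar :: "real set \<Rightarrow> real \<Rightarrow> real" where
  "haar J x =
    (if x \<in> left_half J then - 1 / sqrt (measure lborel J)
     else if x \<in> right_half J then 1 / sqrt (measure lborel J)
     else 0)"

text \<open>As \<open>haar J\<close> vanishes outside \<open>J\<close>, the inner product is an integral over \<open>J\<close>.\<close>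

definition haar_diff :: "real set \<Rightarrow> (real \<Rightarrow> real) \<Rightarrow> real \<Rightarrow> real" where
  "haar_diff J f x = (LINT t:J|lborel. f t * haar J t) * haar J x"

definition square_function :: "real set \<Rightarrow> (real \<Rightarrow> real) \<Rightarrow> real \<Rightarrow> real" where
  "square_function I f x = sqrt (\<Sum>\<^sub>\<infinity>J\<in>{J \<in> dyadic I. x \<in> J}. (haar_diff J f x)\<^sup>2)"

section \<open>The confluent hypergeometric function\<close>

definition Nfun :: "real \<Rightarrow> real \<Rightarrow> real" where
  "Nfun \<alpha> x = eval_fps (fps_hypergeo [- \<alpha> / 2] [1 / 2] 1) (x\<^sup>2 / 2)"

lemma Nfun_series:
  "Nfun \<alpha> x = (\<Sum>m. (- 2 * x\<^sup>2) ^ m / fact (2 * m) * (\<Prod>k<m. \<alpha> / 2 - real k))"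
proof -
  have fact_double: "fact (2 * m) = 4 ^ m * fact m * pochhammer (1 / 2 :: real) m" for m
    using fact_double [of m, where 'a = real] by (simp add: power_mult)
  have poch: "pochhammer (- \<alpha> / 2) m = (- 1) ^ m * (\<Prod>k<m. \<alpha> / 2 - real k)" for m
    by (induction m) (simp_all add: pochhammer_Suc algebra_simps)
  have power: "(- 2 * x\<^sup>2) ^ m = (- 1) ^ m * 4 ^ m * (x\<^sup>2 / 2) ^ m" for m
    by (simp flip: power_mult_distrib)
  have "fps_nth (fps_hypergeo [- \<alpha> / 2] [1 / 2] 1) m * (x\<^sup>2 / 2) ^ m =
      (- 2 * x\<^sup>2) ^ m / fact (2 * m) * (\<Prod>k<m. \<alpha> / 2 - real k)" for m
    unfolding fact_double poch power fps_hypergeo_nth by (simp add: poch [simplified] mult_ac)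
  then show ?thesis
    unfolding Nfun_def eval_fps_def by presburger
qed

definition c_zero :: "real \<Rightarrow> real" where
  "c_zero \<alpha> = (LEAST c. 0 < c \<and> Nfun \<alpha> c = 0)"

section \<open>The Bellman function\<close>

definition u_fun :: "real \<Rightarrow> real \<Rightarrow> real" where
  "u_fun \<alpha> x =
    (if \<bar>x\<bar> \<le> c_zero \<alpha>
     then - (\<alpha> * c_zero \<alpha> powr (\<alpha> - 1) / deriv (Nfun \<alpha>) (c_zero \<alpha>)) * Nfun \<alpha> x
     else c_zero \<alpha> powr \<alpha> - \<bar>x\<bar> powr \<alpha>)"

definition U_fun :: "real \<Rightarrow> real \<Rightarrow> real \<Rightarrow> real" where
  "U_fun \<alpha> p q =
    (if q \<noteq> 0 then \<bar>q\<bar> powr \<alpha> * u_fun \<alpha> (\<bar>p\<bar> / \<bar>q\<bar>) else - (\<bar>p\<bar> powr \<alpha>))"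

text \<open>The supremum is taken in the extended reals, so that an equation with a real number
  includes the finiteness of the supremum.\<close>

definition bellman :: "real \<Rightarrow> real set \<Rightarrow> real \<Rightarrow> real \<Rightarrow> ereal" where
  "bellman \<alpha> I p q =
    (SUP f \<in> {f \<in> test_functions I. average I f = p}.
      ereal (average I (\<lambda>x.
        c_zero \<alpha> powr \<alpha> * (q\<^sup>2 + (square_function I f x)\<^sup>2) powr (\<alpha> / 2) - \<bar>f x\<bar> powr \<alpha>)))"

end

theory Submission
  imports Defs "HOL-Real_Asymp.Real_Asymp"
begin

text \<open>
  Splitting \<open>I\<close> into its halves turns the state \<open>(p, r)\<close>, with \<open>r = q\<^sup>2\<close>, into \<open>(p \<plusminus> a, r + a\<^sup>2)\<close>,
  where \<open>a\<close> is the Haar increment.  So the Bellman function is the least majorant \<open>B\<close> of the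
  obstacle \<open>c\<^sup>\<alpha> r\<^bsup>\<alpha>/2\<^esup> - \<bar>p\<bar>\<^sup>\<alpha>\<close> with \<open>2 B(p, r) \<ge> B(p + a, r + a\<^sup>2) + B(p - a, r + a\<^sup>2)\<close>.

  \<open>U\<close> has this property because the right-hand side is nonincreasing in \<open>a > 0\<close>: by homogeneity its
  derivative is a positive multiple of
  \<open>u'(z) - u'(y) + (z - y) (F(z) + F(y))\<close> with \<open>F = (\<alpha> u - x u') / 2\<close> and \<open>y \<le> z\<close>.  On \<open>[-c, c]\<close> one has
  \<open>F = - u'' / 2\<close>, and the expression is the error of the trapezoidal rule for the convex function \<open>u''\<close>; it decreases
  when \<open>z\<close> grows beyond \<open>c\<close>.  All signs follow from \<open>N\<^sub>\<beta>'' = - \<beta> N\<^bsub>\<beta>-2\<^esub>\<close> and the Sturm comparison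
  \<open>N\<^sub>\<beta> > 0\<close> on \<open>[0, c\<^sub>\<alpha>)\<close> for \<open>\<beta> \<le> \<alpha>\<close>.

  Minimality: the function \<open>w = N\<^sub>\<alpha> + \<epsilon>\<close> is a strict subsolution, so for small \<open>a\<close> the infimum of \<open>B(x, 1) / w(x)\<close>
  over \<open>[-s, s]\<close>, \<open>s < c\<close>, cannot be smaller than the value \<open>(c\<^sup>\<alpha> - s\<^sup>\<alpha>) / w(s)\<close> forced by the obstacle.
  Let \<open>\<epsilon> \<rightarrow> 0\<close> and then \<open>s \<rightarrow> c\<close>.
\<close>

subsection \<open>The functions \<open>N\<^sub>\<beta>\<close>\<close>

definition Nfun_fps :: "real \<Rightarrow> real fps" where
  "Nfun_fps \<beta> = fps_hypergeo [- \<beta> / 2] [1 / 2] 1"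

lemma Nfun_eq_eval_fps: "Nfun \<beta> = (\<lambda>x. eval_fps (Nfun_fps \<beta>) (x\<^sup>2 / 2))"
  by (simp add: fun_eq_iff Nfun_def Nfun_fps_def)

lemma Nfun_fps_nth: "fps_nth (Nfun_fps \<beta>) n = pochhammer (- (\<beta> / 2)) n / (pochhammer (1 / 2) n * fact n)"
  by (simp add: Nfun_fps_def)

lemma Nfun_fps_nth_Suc:
  "fps_nth (Nfun_fps \<beta>) (Suc n) = fps_nth (Nfun_fps \<beta>) n * ((n - \<beta> / 2) / ((n + 1/2) * (n + 1)))"
  by (simp add: Nfun_fps_nth pochhammer_Suc field_simps)

text \<open>A rising factorial of \<open>- (\<beta> / 2)\<close> can be split at its last or at its
  first factor. The second splitting raises the base by 1, that is, it replaces \<beta> by \<beta> -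
  2; both contiguous relations below rest on this.\<close>

lemma Nfun_fps_nth_shift: "(2 * n - \<beta>) * fps_nth (Nfun_fps \<beta>) n = - \<beta> * fps_nth (Nfun_fps (\<beta> - 2)) n"
proof -
  have "pochhammer (- (\<beta> / 2)) n * (- (\<beta> / 2) + n) = - (\<beta> / 2) * pochhammer (- (\<beta> / 2) + 1) n"
    using pochhammer_Suc[of "- (\<beta> / 2)" n] pochhammer_rec[of "- (\<beta> / 2)" n] by simp
  also have "- (\<beta> / 2) + 1 = - ((\<beta> - 2) / 2)"
    by argo
  finally have "(2 * n - \<beta>) * pochhammer (- (\<beta> / 2)) n = - \<beta> * pochhammer (- ((\<beta> - 2) / 2)) n"
    by (simp add: algebra_simps)
  then show ?thesis
    by (simp add: Nfun_fps_nth)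
qed

lemma Nfun_fps_conv_radius [simp]: "fps_conv_radius (Nfun_fps \<beta>) = \<infinity>"
proof (cases "\<exists>n. fps_nth (Nfun_fps \<beta>) n = 0")
  \<comment> \<open>One vanishing coefficient forces all later ones to vanish, so the series is a
    polynomial (\<beta> / 2 is a natural number). In the other case the ratio test applies.\<close>
  case True
  then obtain k where k: "fps_nth (Nfun_fps \<beta>) k = 0" by blast
  have "fps_nth (Nfun_fps \<beta>) (k + n) = 0" for n
    by (induction n) (simp_all add: k Nfun_fps_nth_Suc)
  then have "\<forall>\<^sub>F n in sequentially. fps_nth (Nfun_fps \<beta>) n = 0"
    unfolding eventually_sequentially by (metis le_Suc_ex)
  then have "conv_radius (fps_nth (Nfun_fps \<beta>)) = conv_radius (\<lambda>_. 0 :: real)"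
    by (intro conv_radius_cong) (auto elim: eventually_mono)
  then show ?thesis
    by (simp add: fps_conv_radius_def)
next
  case False
  have "(\<lambda>n. norm (fps_nth (Nfun_fps \<beta>) n) / norm (fps_nth (Nfun_fps \<beta>) (Suc n)))
        = (\<lambda>n. \<bar>((real n + 1/2) * (real n + 1)) / (real n - \<beta> / 2)\<bar>)"
    using False by (subst Nfun_fps_nth_Suc) (auto simp: abs_mult fun_eq_iff)
  moreover have "filterlim (\<lambda>n. \<bar>((real n + 1/2) * (real n + 1)) / (real n - \<beta> / 2)\<bar>) at_top sequentially"
    by real_asymp
  ultimately have "(\<lambda>n. ereal (norm (fps_nth (Nfun_fps \<beta>) n) / norm (fps_nth (Nfun_fps \<beta>) (Suc n)))) \<longlonglongrightarrow> \<infinity>"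
    by (simp only: tendsto_PInfty_eq_at_top)
  then show ?thesis
    unfolding fps_conv_radius_def using False by (intro conv_radius_ratio_limit_ereal) auto
qed

lemma Nfun_fps_deriv_conv_radius [simp]:
  "fps_conv_radius (fps_deriv (Nfun_fps \<beta>)) = \<infinity>"
  "fps_conv_radius (fps_deriv (fps_deriv (Nfun_fps \<beta>))) = \<infinity>"
  using fps_conv_radius_deriv[of "Nfun_fps \<beta>"] fps_conv_radius_deriv[of "fps_deriv (Nfun_fps \<beta>)"] by simp_all

lemma eval_Nfun_fps_shift:
  "- \<beta> * eval_fps (Nfun_fps (\<beta> - 2)) y = 2 * y * eval_fps (fps_deriv (Nfun_fps \<beta>)) y - \<beta> * eval_fps (Nfun_fps \<beta>) y"
proof -
  have "fps_const (- \<beta>) * Nfun_fps (\<beta> - 2) = fps_const 2 * (fps_X * fps_deriv (Nfun_fps \<beta>)) + fps_const (- \<beta>) * Nfun_fps \<beta>"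
  proof (rule fps_ext)
    show "fps_nth (fps_const (- \<beta>) * Nfun_fps (\<beta> - 2)) n
      = fps_nth (fps_const 2 * (fps_X * fps_deriv (Nfun_fps \<beta>)) + fps_const (- \<beta>) * Nfun_fps \<beta>) n" for n
      using Nfun_fps_nth_shift[of n \<beta>] by (cases n) (auto simp: algebra_simps)
  qed
  from arg_cong[OF this, of "\<lambda>f. eval_fps f y"] show ?thesis
    by (simp add: eval_fps_add eval_fps_mult less_le_trans[OF _ fps_conv_radius_mult])
qed

text \<open>For y = x^2 / 2 and a series F, the second derivative of F(x^2 / 2) in x is F'(y) + 2 y
  F''(y). Hence this is the relation N_\<beta>'' = - \<beta> N_(\<beta>-2).\<close>

lemma eval_Nfun_fps_shift':
  "- \<beta> * eval_fps (Nfun_fps (\<beta> - 2)) y =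
    eval_fps (fps_deriv (Nfun_fps \<beta>)) y + 2 * y * eval_fps (fps_deriv (fps_deriv (Nfun_fps \<beta>))) y"
proof -
  have "fps_const (- \<beta>) * Nfun_fps (\<beta> - 2)
      = fps_deriv (Nfun_fps \<beta>) + fps_const 2 * (fps_X * fps_deriv (fps_deriv (Nfun_fps \<beta>)))"
  proof (rule fps_ext)
    fix n
    have "(2 * n + 1) * (n + 1) * fps_nth (Nfun_fps \<beta>) (Suc n) = (2 * n - \<beta>) * fps_nth (Nfun_fps \<beta>) n"
      unfolding Nfun_fps_nth_Suc by (simp add: divide_simps) (simp add: algebra_simps)
    with Nfun_fps_nth_shift[of n \<beta>] show "fps_nth (fps_const (- \<beta>) * Nfun_fps (\<beta> - 2)) n
      = fps_nth (fps_deriv (Nfun_fps \<beta>) + fps_const 2 * (fps_X * fps_deriv (fps_deriv (Nfun_fps \<beta>)))) n"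
      by (cases n) (auto simp: algebra_simps)
  qed
  from arg_cong[OF this, of "\<lambda>f. eval_fps f y"] show ?thesis
    by (simp add: eval_fps_add eval_fps_mult less_le_trans[OF _ fps_conv_radius_mult])
qed

lemma has_real_derivative_eval_fps:
  fixes f :: "real fps"
  assumes "fps_conv_radius f = \<infinity>"
  shows "((\<lambda>x. eval_fps f (x\<^sup>2 / 2)) has_real_derivative x * eval_fps (fps_deriv f) (x\<^sup>2 / 2)) (at x)"
proof -
  have "(eval_fps f has_real_derivative eval_fps (fps_deriv f) (x\<^sup>2 / 2)) (at (x\<^sup>2 / 2))"
    by (rule has_field_derivative_eval_fps) (simp add: assms)
  moreover have "((\<lambda>x. x\<^sup>2 / 2) has_real_derivative x) (at x)"
    by (auto intro!: derivative_eq_intros)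
  ultimately show ?thesis
    by (rule DERIV_chain2[THEN DERIV_cong]) simp
qed

lemma deriv_Nfun: "deriv (Nfun \<beta>) x = x * eval_fps (fps_deriv (Nfun_fps \<beta>)) (x\<^sup>2 / 2)"
  using has_real_derivative_eval_fps[of "Nfun_fps \<beta>" x]
  by (intro DERIV_imp_deriv) (simp add: Nfun_eq_eval_fps)

lemma has_derivative_Nfun: "(Nfun \<beta> has_real_derivative deriv (Nfun \<beta>) x) (at x)"
  using has_real_derivative_eval_fps[of "Nfun_fps \<beta>" x] unfolding deriv_Nfun
  by (simp add: Nfun_eq_eval_fps)

lemma has_derivative_deriv_Nfun:
  "(deriv (Nfun \<beta>) has_real_derivative - \<beta> * Nfun (\<beta> - 2) x) (at x)"
proof -
  have "((\<lambda>x. x * eval_fps (fps_deriv (Nfun_fps \<beta>)) (x\<^sup>2 / 2)) has_real_derivative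
    eval_fps (fps_deriv (Nfun_fps \<beta>)) (x\<^sup>2 / 2) + x * (x * eval_fps (fps_deriv (fps_deriv (Nfun_fps \<beta>))) (x\<^sup>2 / 2))) (at x)"
    by (rule derivative_eq_intros has_real_derivative_eval_fps refl | simp)+
  also have "eval_fps (fps_deriv (Nfun_fps \<beta>)) (x\<^sup>2 / 2) + x * (x * eval_fps (fps_deriv (fps_deriv (Nfun_fps \<beta>))) (x\<^sup>2 / 2))
    = - \<beta> * Nfun (\<beta> - 2) x"
    using eval_Nfun_fps_shift'[of \<beta> "x\<^sup>2 / 2"] by (simp add: Nfun_eq_eval_fps power2_eq_square)
  finally show ?thesis
    by (simp add: deriv_Nfun[abs_def])
qed

text \<open>The left-hand side is N_\<beta>'' by \<open>has_derivative_deriv_Nfun\<close>, so this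
  is the differential equation of N_\<beta>.\<close>

lemma Nfun_ode: "- \<beta> * Nfun (\<beta> - 2) x = x * deriv (Nfun \<beta>) x - \<beta> * Nfun \<beta> x"
  using eval_Nfun_fps_shift[of \<beta> "x\<^sup>2 / 2"]
  by (simp add: deriv_Nfun) (simp add: Nfun_eq_eval_fps power2_eq_square)

lemma Nfun_0: "Nfun \<beta> 0 = 1"
  by (simp add: Nfun_def eval_fps_at_0)

lemma deriv_Nfun_0: "deriv (Nfun \<beta>) 0 = 0"
  by (simp add: deriv_Nfun)

lemma Nfun_minus: "Nfun \<beta> (- x) = Nfun \<beta> x"
  by (simp add: Nfun_def)

lemma deriv_Nfun_minus: "deriv (Nfun \<beta>) (- x) = - deriv (Nfun \<beta>) x"
  by (simp add: deriv_Nfun)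

lemma Nfun_2: "Nfun 2 x = 1 - x\<^sup>2"
proof -
  have "Nfun_fps 2 = 1 - fps_const 2 * fps_X"
  proof (rule fps_ext)
    fix n
    show "fps_nth (Nfun_fps 2) n = fps_nth (1 - fps_const 2 * fps_X) n"
    proof (induction n)
      case (Suc n)
      then show ?case by (cases "n = 0"; cases "n = 1") (simp_all add: Nfun_fps_nth_Suc)
    qed (simp add: Nfun_fps_def)
  qed
  then show ?thesis
    by (simp add: Nfun_eq_eval_fps eval_fps_diff eval_fps_mult less_le_trans[OF _ fps_conv_radius_mult])
qed

section \<open>Wronskian and Sturm comparison\<close>

lemma continuous_on_Nfun [continuous_intros]: "continuous_on A (Nfun \<beta>)"
  by (meson DERIV_isCont continuous_at_imp_continuous_on has_derivative_Nfun)

text \<open>Lagrange's identity: the weight \<open>exp (- (x\<^sup>2 / 2))\<close> puts both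
  equations into self-adjoint form, so that the first-order terms cancel.\<close>

lemma Nfun_wronskian:
  "((\<lambda>x. exp (- (x\<^sup>2 / 2)) * (deriv (Nfun \<beta>) x * Nfun \<alpha> x - Nfun \<beta> x * deriv (Nfun \<alpha>) x))
    has_real_derivative exp (- (x\<^sup>2 / 2)) * ((\<alpha> - \<beta>) * Nfun \<alpha> x * Nfun \<beta> x)) (at x)"
proof -
  let ?w = "\<lambda>x. deriv (Nfun \<beta>) x * Nfun \<alpha> x - Nfun \<beta> x * deriv (Nfun \<alpha>) x"
  have "((\<lambda>x. exp (- (x\<^sup>2 / 2))) has_real_derivative exp (- (x\<^sup>2 / 2)) * (- x)) (at x)"
    by (rule derivative_eq_intros refl | simp)+
  moreover have "(?w has_real_derivative - \<beta> * Nfun (\<beta> - 2) x * Nfun \<alpha> x - Nfun \<beta> x * (- \<alpha> * Nfun (\<alpha> - 2) x)) (at x)"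
    by (rule derivative_eq_intros has_derivative_Nfun has_derivative_deriv_Nfun refl | simp)+
  ultimately show ?thesis
    unfolding Nfun_ode
    by (rule DERIV_mult[THEN DERIV_cong]) (simp add: algebra_simps)
qed

text \<open>The Wronskian vanishes at 0 and, by \<open>Nfun_wronskian\<close>, stays nonnegative as
  long as both functions are. It is the numerator of the derivative of N_\<beta> / N_\<alpha>, which
  therefore grows from its value 1 at 0.\<close>

lemma Nfun_compare:
  assumes "\<beta> \<le> \<alpha>" "0 \<le> d" and \<alpha>: "\<And>x. 0 \<le> x \<Longrightarrow> x \<le> d \<Longrightarrow> 0 < Nfun \<alpha> x"
    and \<beta>: "\<And>x. 0 \<le> x \<Longrightarrow> x \<le> d \<Longrightarrow> 0 \<le> Nfun \<beta> x"
  shows "Nfun \<alpha> d \<le> Nfun \<beta> d"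
proof -
  define G where "G x = exp (- (x\<^sup>2 / 2)) * (deriv (Nfun \<beta>) x * Nfun \<alpha> x - Nfun \<beta> x * deriv (Nfun \<alpha>) x)" for x
  have G: "G 0 \<le> G x" if "0 \<le> x" "x \<le> d" for x
  proof (rule DERIV_nonneg_imp_nondecreasing[OF that(1)])
    fix y assume "0 \<le> y" "y \<le> x"
    then have "0 \<le> exp (- (y\<^sup>2 / 2)) * ((\<alpha> - \<beta>) * Nfun \<alpha> y * Nfun \<beta> y)"
      using that \<alpha>[of y] \<beta>[of y] \<open>\<beta> \<le> \<alpha>\<close> by simp
    with Nfun_wronskian show "\<exists>D. (G has_real_derivative D) (at y) \<and> 0 \<le> D"
      unfolding G_def[abs_def] by blast
  qed
  have W: "0 \<le> deriv (Nfun \<beta>) x * Nfun \<alpha> x - Nfun \<beta> x * deriv (Nfun \<alpha>) x" if "0 \<le> x" "x \<le> d" for x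
    using G[OF that] by (simp add: G_def deriv_Nfun_0 zero_le_mult_iff)
  have "Nfun \<beta> 0 / Nfun \<alpha> 0 \<le> Nfun \<beta> d / Nfun \<alpha> d"
  proof (rule DERIV_nonneg_imp_nondecreasing[OF \<open>0 \<le> d\<close>])
    fix x assume x: "0 \<le> x" "x \<le> d"
    have "((\<lambda>x. Nfun \<beta> x / Nfun \<alpha> x) has_real_derivative
      (deriv (Nfun \<beta>) x * Nfun \<alpha> x - Nfun \<beta> x * deriv (Nfun \<alpha>) x) / (Nfun \<alpha> x * Nfun \<alpha> x)) (at x)"
      using \<alpha>[OF x] by (intro DERIV_divide has_derivative_Nfun) auto
    then show "\<exists>D. ((\<lambda>x. Nfun \<beta> x / Nfun \<alpha> x) has_real_derivative D) (at x) \<and> 0 \<le> D"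
      using W[OF x] \<alpha>[OF x] by (intro exI conjI) auto
  qed
  then show ?thesis
    using \<alpha>[of d] \<open>0 \<le> d\<close> by (simp add: Nfun_0 field_simps)
qed

lemma least_zero:
  fixes f :: "real \<Rightarrow> real"
  assumes cont: "continuous_on {a..b} f" and "0 < f a" "f b \<le> 0" "a \<le> b"
  obtains d where "a < d" "d \<le> b" "f d = 0" "\<And>x. a \<le> x \<Longrightarrow> x < d \<Longrightarrow> 0 < f x"
proof -
  define Z where "Z = {x \<in> {a..b}. f x = 0}"
  have zero: "\<exists>z \<in> Z. z \<le> x" if "f x \<le> 0" "a \<le> x" "x \<le> b" for x
  proof -
    have "\<exists>z\<ge>a. z \<le> x \<and> f z = 0"
      using that assms by (intro IVT2') (auto intro: continuous_on_subset[OF cont])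
    with that show ?thesis by (auto simp: Z_def)
  qed
  have "closed Z"
    unfolding Z_def by (rule continuous_closed_preimage_constant[OF cont]) simp
  then have "compact Z"
    using compact_Int_closed[of "{a..b}" Z] by (simp add: Z_def Int_absorb1 Collect_mono_iff subset_iff)
  moreover have "Z \<noteq> {}"
    using zero[of b] assms by auto
  ultimately obtain d where d: "d \<in> Z" "\<And>z. z \<in> Z \<Longrightarrow> d \<le> z"
    by (meson compact_attains_inf)
  show ?thesis
  proof
    show "a < d" "d \<le> b" "f d = 0"
      using d(1) \<open>0 < f a\<close> by (auto simp: Z_def order_less_le)
    show "0 < f x" if "a \<le> x" "x < d" for x
      using zero[of x] d that \<open>d \<le> b\<close> by (force simp: not_less)
  qed
qed

text \<open>At a first zero e of N_\<beta>, \<open>Nfun_compare\<close> would give N_\<alpha>(e)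
  \<le> N_\<beta>(e) = 0.\<close>

lemma Nfun_sturm:
  assumes "\<beta> \<le> \<alpha>" "0 \<le> d" and \<alpha>: "\<And>x. 0 \<le> x \<Longrightarrow> x \<le> d \<Longrightarrow> 0 < Nfun \<alpha> x"
  shows "0 < Nfun \<beta> d"
proof (rule ccontr)
  assume "\<not> 0 < Nfun \<beta> d"
  then have "Nfun \<beta> d \<le> 0" by simp
  then obtain e where e: "0 < e" "e \<le> d" "Nfun \<beta> e = 0" "\<And>x. 0 \<le> x \<Longrightarrow> x < e \<Longrightarrow> 0 < Nfun \<beta> x"
    using least_zero[of 0 d "Nfun \<beta>", OF continuous_on_Nfun _ _ \<open>0 \<le> d\<close>] Nfun_0 zero_less_one by metis
  have "Nfun \<alpha> e \<le> Nfun \<beta> e"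
  proof (rule Nfun_compare[OF \<open>\<beta> \<le> \<alpha>\<close>])
    show "0 \<le> Nfun \<beta> x" if "0 \<le> x" "x \<le> e" for x
      using e(3) e(4)[OF that(1)] that(2) by (cases "x = e") (simp_all add: order_le_less)
    show "0 < Nfun \<alpha> x" if "0 \<le> x" "x \<le> e" for x
      using \<alpha>[OF that(1)] that(2) e(2) by linarith
  qed (use e(1) in simp)
  with e(1-3) \<alpha>[of e] show False by simp
qed

subsection \<open>Reduction to a recursion on the dyadic tree\<close>

text \<open>The interval is forgotten: v is the average payoff of some test function with mean p,
  where r stands in for q^2. A leaf is a constant function. At a node, a is half the difference of
  the means on the two halves, and its square is the contribution of the top Haar function to
  (Sf)^2.\<close>

inductive attain :: "real \<Rightarrow> real \<Rightarrow> real \<Rightarrow> real \<Rightarrow> bool" for \<alpha> where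
  leaf: "attain \<alpha> p r (c_zero \<alpha> powr \<alpha> * r powr (\<alpha> / 2) - \<bar>p\<bar> powr \<alpha>)"
| node: "attain \<alpha> (p + a) (r + a\<^sup>2) v \<Longrightarrow> attain \<alpha> (p - a) (r + a\<^sup>2) w \<Longrightarrow> attain \<alpha> p r ((v + w) / 2)"


text \<open>The given interval may contain either of its end points, and halving produces half-open
  intervals; this predicate covers all these cases and excludes degenerate ones.\<close>

definition spans :: "real set \<Rightarrow> real \<Rightarrow> real \<Rightarrow> bool" where
  "spans I a b \<longleftrightarrow> a < b \<and> {a<..<b} \<subseteq> I \<and> I \<subseteq> {a..b}"

text \<open>I is the open interval plus at most two points, hence measurable, and its measure is
  squeezed between those of the open and the closed interval.\<close>

lemma spansD:
  assumes "spans I a b"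
  shows spans_Inf: "Inf I = a" and spans_Sup: "Sup I = b"
    and spans_sets: "I \<in> sets lborel" and spans_measure: "measure lborel I = b - a"
    and spans_integrable_const: "set_integrable lborel I (\<lambda>_. k :: real)"
    and spans_integral_const: "(LINT x:I|lborel. k) = (b - a) * k"
proof -
  have ab: "a < b" "{a<..<b} \<subseteq> I" "I \<subseteq> {a..b}"
    using assms by (auto simp: spans_def)
  then have bd: "bdd_below I" "bdd_above I" "I \<noteq> {}"
    by (auto intro: bdd_below_mono bdd_above_mono)
  have "Inf I \<le> Inf {a<..<b}" "Sup {a<..<b} \<le> Sup I"
    using ab bd cInf_superset_mono[of "{a<..<b}" I] cSup_subset_mono[of "{a<..<b}" I] by simp_all
  moreover have "a \<le> Inf I" "Sup I \<le> b"
    using ab bd by (auto intro!: cInf_greatest cSup_least)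
  ultimately show "Inf I = a" "Sup I = b"
    using ab by (simp_all add: order_antisym)
  have "I = {a<..<b} \<union> (I \<inter> {a, b})"
    using ab by force
  moreover have "{a<..<b} \<union> (I \<inter> {a, b}) \<in> sets lborel"
    by (intro sets.Un) (auto intro!: borel_closed finite_imp_closed)
  ultimately show I: "I \<in> sets lborel" by metis
  have fab: "{a..b} \<in> fmeasurable lborel"
    by (simp add: fmeasurable_def emeasure_lborel_Icc_eq)
  then have fm: "I \<in> fmeasurable lborel"
    using ab(3) I by (rule fmeasurableI2)
  have "measure lborel {a<..<b} \<le> measure lborel I" "measure lborel I \<le> measure lborel {a..b}"
    using measure_mono_fmeasurable[OF ab(2) _ fm] measure_mono_fmeasurable[OF ab(3) I fab] by simp_all
  then show m: "measure lborel I = b - a"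
    using ab by simp
  have "has_bochner_integral lborel (\<lambda>x. indicator I x *\<^sub>R k) (measure lborel I *\<^sub>R k)"
    using fm by (intro has_bochner_integral_indicator) (auto simp: fmeasurable_def)
  then show "set_integrable lborel I (\<lambda>_. k)" "(LINT x:I|lborel. k) = (b - a) * k"
    by (simp_all add: has_bochner_integral_iff set_integrable_def set_lebesgue_integral_def m)
qed

section \<open>Averages over the two halves and the Haar increment\<close>

lemma spans_nonempty: "spans I a b \<Longrightarrow> I \<noteq> {}"
  unfolding spans_def by (metis greaterThanLessThan_empty_iff not_le subset_empty)

lemma spans_midpt: "spans I a b \<Longrightarrow> midpt I = (a + b) / 2"
  by (simp add: midpt_def spansD)

lemma spans_left: "spans I a b \<Longrightarrow> spans (left_half I) a ((a + b) / 2)"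
  unfolding left_half_def by (auto simp: spans_midpt) (auto simp: spans_def subset_iff)

lemma spans_right: "spans I a b \<Longrightarrow> spans (right_half I) ((a + b) / 2) b"
  unfolding right_half_def by (auto simp: spans_midpt) (auto simp: spans_def subset_iff)

lemma halves: "left_half I \<union> right_half I = I" "left_half I \<inter> right_half I = {}"
  by (auto simp: left_half_def right_half_def)

lemma average_const:
  assumes "spans I a b" "\<And>x. x \<in> I \<Longrightarrow> f x = k"
  shows "average I f = k"
proof -
  have "(LINT x:I|lborel. f x) = (LINT x:I|lborel. k)"
    using assms spans_sets by (intro set_lebesgue_integral_cong) auto
  also have "\<dots> = (b - a) * k"
    by (rule spans_integral_const[OF assms(1)])
  finally show ?thesis
    using assms(1) spans_measure[OF assms(1)] by (simp add: average_def spans_def)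
qed

lemma average_cong: "(\<And>x. x \<in> I \<Longrightarrow> f x = g x) \<Longrightarrow> average I f = average I g"
  unfolding average_def set_lebesgue_integral_def
  by (intro arg_cong2[where f = "(/)"] Bochner_Integration.integral_cong) (auto simp: indicator_def)

lemma integral_halves:
  fixes f :: "real \<Rightarrow> real"
  assumes "spans I a b" "set_integrable lborel (left_half I) f" "set_integrable lborel (right_half I) f"
  shows "set_integrable lborel I f"
    "(LINT x:I|lborel. f x) = (LINT x:left_half I|lborel. f x) + (LINT x:right_half I|lborel. f x)"
  using set_integrable_Un[OF assms(2,3)] set_integral_Un[OF halves(2) assms(2,3)]
    spans_sets[OF spans_left[OF assms(1)]] spans_sets[OF spans_right[OF assms(1)]]
  by (simp_all add: halves(1))

lemma integral_eq_average:
  assumes "spans I a b"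
  shows "(LINT x:I|lborel. f x) = (b - a) * average I f"
  using assms spans_measure[OF assms] by (simp add: average_def spans_def)

lemma average_halves:
  assumes "spans I a b" "set_integrable lborel (left_half I) f" "set_integrable lborel (right_half I) f"
  shows "average I f = (average (left_half I) f + average (right_half I) f) / 2"
proof -
  have "(b - a) * average I f = (b - a) * ((average (left_half I) f + average (right_half I) f) / 2)"
    using integral_halves(2)[OF assms]
    by (simp add: integral_eq_average[OF assms(1)] integral_eq_average[OF spans_left[OF assms(1)]]
        integral_eq_average[OF spans_right[OF assms(1)]] field_simps)
  with assms(1) show ?thesis by (simp add: spans_def)
qed

text \<open>The inner product with h_I is the square root of |I| times half the jump between the two
  averages, while h_I^2 = 1 / |I| on I, so the length cancels. This identifies the increment a of
  the recursion.\<close>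

lemma haar_diff_square:
  assumes I: "spans I a b" and x: "x \<in> I"
    and l: "set_integrable lborel (left_half I) f" and r: "set_integrable lborel (right_half I) f"
  shows "(haar_diff I f x)\<^sup>2 = ((average (right_half I) f - average (left_half I) f) / 2)\<^sup>2"
proof -
  let ?s = "sqrt (b - a)" and ?d = "(average (right_half I) f - average (left_half I) f) / 2"
  have "0 < b - a" using I by (simp add: spans_def)
  then have s: "?s * ?s = b - a" "0 < ?s" by simp_all
  have hl: "haar I t = - 1 / ?s" if "t \<in> left_half I" for t
    using that by (simp add: haar_def spansD[OF I])
  have hr: "haar I t = 1 / ?s" if "t \<in> right_half I" for t
    using that halves(2)[of I] by (auto simp: haar_def spansD[OF I])
  have fl: "set_integrable lborel (left_half I) (\<lambda>t. f t * haar I t)"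
    using set_integrable_mult_left[of "- 1 / ?s", OF l] by (subst set_integrable_cong[OF refl refl]) (auto simp: hl)
  have fr: "set_integrable lborel (right_half I) (\<lambda>t. f t * haar I t)"
    using set_integrable_mult_left[of "1 / ?s", OF r] by (subst set_integrable_cong[OF refl refl]) (auto simp: hr)
  have "(LINT t:left_half I|lborel. f t * haar I t) = (LINT t:left_half I|lborel. f t * (- 1 / ?s))"
    using spans_sets[OF spans_left[OF I]] hl by (intro set_lebesgue_integral_cong) auto
  also have "\<dots> = - ((b - a) / 2 * average (left_half I) f / ?s)"
    by (simp only: set_integral_mult_left integral_eq_average[OF spans_left[OF I]]) (simp add: field_simps)
  finally have il: "(LINT t:left_half I|lborel. f t * haar I t) = - ((b - a) / 2 * average (left_half I) f / ?s)" .
  have "(LINT t:right_half I|lborel. f t * haar I t) = (LINT t:right_half I|lborel. f t * (1 / ?s))"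
    using spans_sets[OF spans_right[OF I]] hr by (intro set_lebesgue_integral_cong) auto
  also have "\<dots> = (b - a) / 2 * average (right_half I) f / ?s"
    by (simp only: set_integral_mult_left integral_eq_average[OF spans_right[OF I]]) (simp add: field_simps)
  finally have "(LINT t:I|lborel. f t * haar I t) =
      - ((b - a) / 2 * average (left_half I) f / ?s) + (b - a) / 2 * average (right_half I) f / ?s"
    unfolding integral_halves(2)[OF I fl fr] il by (rule arg_cong)
  moreover have "- (h / 2 * u / w) + h / 2 * v / w = h * ((v - u) / 2) / w" for h u v w :: real
    by (simp add: right_diff_distrib diff_divide_distrib)
  ultimately have "(LINT t:I|lborel. f t * haar I t) = (b - a) * ?d / ?s"
    by simp
  moreover have "haar I x = - 1 / ?s \<or> haar I x = 1 / ?s"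
    using x halves(1)[of I] hl[of x] hr[of x] by blast
  then have "(haar I x)\<^sup>2 = 1 / (b - a)"
    using \<open>0 < b - a\<close> by (elim disjE) (simp_all add: power_divide)
  moreover have "(haar_diff I f x)\<^sup>2 = (LINT t:I|lborel. f t * haar I t)\<^sup>2 * (haar I x)\<^sup>2"
    by (simp only: haar_diff_def power_mult_distrib)
  ultimately have "(haar_diff I f x)\<^sup>2 = ((b - a) * ?d / ?s)\<^sup>2 * (1 / (b - a))"
    by (simp only:)
  also have "\<dots> = ?d\<^sup>2"
  proof -
    have "(h * u / sqrt h)\<^sup>2 * (1 / h) = u\<^sup>2" if "0 < h" for h u :: real
      using that by (simp add: power_divide power_mult_distrib) (simp add: power2_eq_square)
    with \<open>0 < b - a\<close> show ?thesis by blast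
  qed
  finally show ?thesis .
qed

section \<open>The branch of dyadic intervals through a point\<close>

lemma haar_diff_cong: "(\<And>x. x \<in> J \<Longrightarrow> f x = g x) \<Longrightarrow> haar_diff J f = haar_diff J g"
  unfolding haar_diff_def set_lebesgue_integral_def
  by (intro ext arg_cong2[where f = "(*)"] Bochner_Integration.integral_cong) (auto simp: indicator_def)

text \<open>The definition refines the smallest intervals, whereas the inductions below split the
  tree at its root.\<close>

lemma dyadic_gen_Suc: "dyadic_gen (Suc N) I = dyadic_gen N (left_half I) \<union> dyadic_gen N (right_half I)"
  by (induction N) auto

lemma dyadic_gen_spans:
  "J \<in> dyadic_gen N I \<Longrightarrow> spans I a b \<Longrightarrow> J \<subseteq> I \<and> (\<exists>a b. spans J a b)"
proof (induction N arbitrary: I a b)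
  case (Suc N)
  from Suc.prems(1) consider "J \<in> dyadic_gen N (left_half I)" | "J \<in> dyadic_gen N (right_half I)"
    unfolding dyadic_gen_Suc by blast
  then show ?case
  proof cases
    case 1
    from Suc.IH[OF 1 spans_left[OF Suc.prems(2)]] halves(1)[of I] show ?thesis by blast
  next
    case 2
    from Suc.IH[OF 2 spans_right[OF Suc.prems(2)]] halves(1)[of I] show ?thesis by blast
  qed
qed auto

lemma dyadic_halves: "dyadic I = insert I (dyadic (left_half I) \<union> dyadic (right_half I))"
proof -
  have "(\<exists>N. J \<in> dyadic_gen N I) \<longleftrightarrow> J \<in> dyadic_gen 0 I \<or> (\<exists>N. J \<in> dyadic_gen (Suc N) I)" for J
    by (metis not0_implies_Suc)
  then show ?thesis
    unfolding dyadic_gen_Suc by (auto simp: dyadic_def)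
qed

lemma dyadic_subset: "J \<in> dyadic I \<Longrightarrow> spans I a b \<Longrightarrow> J \<subseteq> I"
  using dyadic_gen_spans[of J _ I a b] by (auto simp: dyadic_def)

text \<open>Passing to a half removes exactly one interval from the branch through x. As the sum for
  Sf runs over a set, I must really be a new element; it is, because the other half is
  nonempty.\<close>

lemma dyadic_at_left:
  assumes "spans I a b" "x \<in> left_half I"
  shows "{J \<in> dyadic I. x \<in> J} = insert I {J \<in> dyadic (left_half I). x \<in> J}"
    "I \<notin> {J \<in> dyadic (left_half I). x \<in> J}"
proof -
  have "x \<in> I" "x \<notin> right_half I" using assms(2) halves[of I] by auto
  then show "{J \<in> dyadic I. x \<in> J} = insert I {J \<in> dyadic (left_half I). x \<in> J}"
    using dyadic_subset[OF _ spans_right[OF assms(1)]] by (auto simp: dyadic_halves[of I])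
  obtain y where "y \<in> right_half I"
    using spans_nonempty[OF spans_right[OF assms(1)]] by blast
  then have "\<not> I \<subseteq> left_half I" using halves[of I] by blast
  then show "I \<notin> {J \<in> dyadic (left_half I). x \<in> J}"
    using dyadic_subset[OF _ spans_left[OF assms(1)]] by auto
qed

lemma dyadic_at_right:
  assumes "spans I a b" "x \<in> right_half I"
  shows "{J \<in> dyadic I. x \<in> J} = insert I {J \<in> dyadic (right_half I). x \<in> J}"
    "I \<notin> {J \<in> dyadic (right_half I). x \<in> J}"
proof -
  have "x \<in> I" "x \<notin> left_half I" using assms(2) halves[of I] by auto
  then show "{J \<in> dyadic I. x \<in> J} = insert I {J \<in> dyadic (right_half I). x \<in> J}"
    using dyadic_subset[OF _ spans_left[OF assms(1)]] by (auto simp: dyadic_halves[of I])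
  obtain y where "y \<in> left_half I"
    using spans_nonempty[OF spans_left[OF assms(1)]] by blast
  then have "\<not> I \<subseteq> right_half I" using halves[of I] by blast
  then show "I \<notin> {J \<in> dyadic (right_half I). x \<in> J}"
    using dyadic_subset[OF _ spans_right[OF assms(1)]] by auto
qed

text \<open>The integrand of the Bellman function with q^2 replaced by a free r, since r changes
  when the tree is descended.\<close>

definition payoff :: "real \<Rightarrow> real set \<Rightarrow> real \<Rightarrow> (real \<Rightarrow> real) \<Rightarrow> real \<Rightarrow> real" where
  "payoff \<alpha> I r f x = c_zero \<alpha> powr \<alpha> * (r + (square_function I f x)\<^sup>2) powr (\<alpha> / 2) - \<bar>f x\<bar> powr \<alpha>"

text \<open>A divergent \<open>infsum\<close> has the default value 0, so splitting off the term of
  the top interval requires summability to be tracked.\<close>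

definition square_summable :: "real set \<Rightarrow> (real \<Rightarrow> real) \<Rightarrow> real \<Rightarrow> bool" where
  "square_summable I f x \<longleftrightarrow> (\<lambda>J. (haar_diff J f x)\<^sup>2) summable_on {J \<in> dyadic I. x \<in> J}"

lemma square_function_power2: "(square_function I f x)\<^sup>2 = (\<Sum>\<^sub>\<infinity>J\<in>{J \<in> dyadic I. x \<in> J}. (haar_diff J f x)\<^sup>2)"
  by (simp add: square_function_def infsum_nonneg)

lemma payoff_cong:
  assumes "spans I a b" "x \<in> I" "\<And>x. x \<in> I \<Longrightarrow> f x = g x"
  shows "payoff \<alpha> I r f x = payoff \<alpha> I r g x"
proof -
  have eq: "haar_diff J f = haar_diff J g" if "J \<in> dyadic I" for J
  proof (rule haar_diff_cong)
    fix y assume "y \<in> J"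
    then show "f y = g y"
      using dyadic_subset[OF that assms(1)] by (intro assms(3)) blast
  qed
  have "(\<Sum>\<^sub>\<infinity>J\<in>{J \<in> dyadic I. x \<in> J}. (haar_diff J f x)\<^sup>2) =
      (\<Sum>\<^sub>\<infinity>J\<in>{J \<in> dyadic I. x \<in> J}. (haar_diff J g x)\<^sup>2)"
  proof (rule infsum_cong)
    fix J assume "J \<in> {J \<in> dyadic I. x \<in> J}"
    then have "haar_diff J f = haar_diff J g"
      by (intro eq) blast
    then show "(haar_diff J f x)\<^sup>2 = (haar_diff J g x)\<^sup>2"
      by (rule arg_cong)
  qed
  then show ?thesis
    unfolding payoff_def square_function_power2 assms(3)[OF assms(2)] by (simp only:)
qed

text \<open>At a point of the half H the square function satisfies (S_I f)^2 = d^2 + (S_H f)^2,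
  where d is the Haar increment of I; the term d^2 is absorbed into r.\<close>

lemma square_halves:
  assumes I: "spans I a b" and H: "H = left_half I \<or> H = right_half I" and x: "x \<in> H"
    and l: "set_integrable lborel (left_half I) f" and r: "set_integrable lborel (right_half I) f"
    and sum: "square_summable H f x"
  shows "square_summable I f x"
    "payoff \<alpha> I r0 f x = payoff \<alpha> H (r0 + ((average (right_half I) f - average (left_half I) f) / 2)\<^sup>2) f x"
proof -
  have dy: "{J \<in> dyadic I. x \<in> J} = insert I {J \<in> dyadic H. x \<in> J}" "I \<notin> {J \<in> dyadic H. x \<in> J}"
  proof -
    have "{J \<in> dyadic I. x \<in> J} = insert I {J \<in> dyadic H. x \<in> J} \<and> I \<notin> {J \<in> dyadic H. x \<in> J}"
      using H
    proof
      assume "H = left_half I" with x dyadic_at_left[OF I, of x] show ?thesis by metis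
    next
      assume "H = right_half I" with x dyadic_at_right[OF I, of x] show ?thesis by metis
    qed
    then show "{J \<in> dyadic I. x \<in> J} = insert I {J \<in> dyadic H. x \<in> J}" "I \<notin> {J \<in> dyadic H. x \<in> J}"
      by metis+
  qed
  show "square_summable I f x"
    using sum by (simp add: square_summable_def dy(1) summable_on_insert_iff)
  have "x \<in> I" using H x halves(1)[of I] by blast
  with infsum_insert[OF sum[unfolded square_summable_def] dy(2)] haar_diff_square[OF I this l r]
  have "(square_function I f x)\<^sup>2 =
      ((average (right_half I) f - average (left_half I) f) / 2)\<^sup>2 + (square_function H f x)\<^sup>2"
    by (simp add: square_function_power2 dy(1))
  then show "payoff \<alpha> I r0 f x = payoff \<alpha> H (r0 + ((average (right_half I) f - average (left_half I) f) / 2)\<^sup>2) f x"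
    by (simp add: payoff_def add.assoc)
qed

section \<open>Test functions correspond to finite trees\<close>

definition steps :: "nat \<Rightarrow> real set \<Rightarrow> (real \<Rightarrow> real) \<Rightarrow> bool" where
  "steps N I f \<longleftrightarrow> (\<forall>J\<in>dyadic_gen N I. f constant_on J)"

lemma steps_Suc: "steps (Suc N) I f \<longleftrightarrow> steps N (left_half I) f \<and> steps N (right_half I) f"
  unfolding steps_def dyadic_gen_Suc by (rule ball_Un)

lemma steps_mono:
  assumes "N \<le> M" "steps N I f"
  shows "steps M I f"
  using assms
proof (induction rule: dec_induct)
  case (step m)
  have "f constant_on left_half J" "f constant_on right_half J" if "f constant_on J" for J
    using constant_on_subset[OF that] halves(1)[of J] by blast+
  with step show ?case
    unfolding steps_def by auto
qed

lemma steps_cong: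
  assumes "spans I a b" "\<And>x. x \<in> I \<Longrightarrow> f x = g x" "steps N I g"
  shows "steps N I f"
  unfolding steps_def
proof
  fix J assume J: "J \<in> dyadic_gen N I"
  then obtain k where k: "\<forall>x\<in>J. g x = k"
    using assms(3) unfolding steps_def constant_on_def by blast
  have "J \<subseteq> I" using dyadic_gen_spans[OF J assms(1)] by blast
  then have "\<forall>x\<in>J. f x = k"
    using assms(2) k by (simp add: subset_iff)
  then show "f constant_on J"
    unfolding constant_on_def by blast
qed

lemma const_square:
  assumes I: "spans I a b" and x: "x \<in> I" and f: "\<And>y. y \<in> I \<Longrightarrow> f y = k"
  shows "square_summable I f x" "payoff \<alpha> I r f x = c_zero \<alpha> powr \<alpha> * r powr (\<alpha> / 2) - \<bar>k\<bar> powr \<alpha>"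
proof -
  have zero: "(haar_diff J f x)\<^sup>2 = 0" if J_in: "J \<in> {J \<in> dyadic I. x \<in> J}" for J
  proof -
    obtain N where "J \<in> dyadic_gen N I"
      using J_in by (auto simp: dyadic_def)
    then obtain a' b' where J: "spans J a' b'" "J \<subseteq> I"
      using dyadic_gen_spans[OF _ I] by blast
    then have k: "\<And>y. y \<in> left_half J \<Longrightarrow> f y = k" "\<And>y. y \<in> right_half J \<Longrightarrow> f y = k"
      using f halves(1)[of J] by blast+
    have "set_integrable lborel (left_half J) (\<lambda>_. k)" "set_integrable lborel (right_half J) (\<lambda>_. k)"
      using spans_integrable_const spans_left[OF J(1)] spans_right[OF J(1)] by blast+
    then have "set_integrable lborel (left_half J) f" "set_integrable lborel (right_half J) f"
      using k set_integrable_cong[OF refl refl, of "left_half J" f "\<lambda>_. k"]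
        set_integrable_cong[OF refl refl, of "right_half J" f "\<lambda>_. k"] by blast+
    then have "(haar_diff J f x)\<^sup>2 = ((average (right_half J) f - average (left_half J) f) / 2)\<^sup>2"
      using haar_diff_square[OF J(1)] J_in by simp
    also have "\<dots> = 0"
      using average_const[OF spans_left[OF J(1)] k(1)] average_const[OF spans_right[OF J(1)] k(2)] by simp
    finally show ?thesis .
  qed
  then show "square_summable I f x"
    unfolding square_summable_def by (rule summable_on_0)
  from zero have "(square_function I f x)\<^sup>2 = 0"
    unfolding square_function_power2 by (rule infsum_0)
  then show "payoff \<alpha> I r f x = c_zero \<alpha> powr \<alpha> * r powr (\<alpha> / 2) - \<bar>k\<bar> powr \<alpha>"
    using f[OF x] by (simp add: payoff_def)
qed

text \<open>Induction on the depth. Integrability and summability are carried along because averages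
  are split at the midpoint and one term is split off the square function; r is quantified because
  it grows by d^2 at each level.\<close>

lemma steps_attain:
  assumes "spans I a b" "steps N I f"
  shows "set_integrable lborel I f \<and> (\<forall>x\<in>I. square_summable I f x) \<and>
    (\<forall>r. set_integrable lborel I (payoff \<alpha> I r f) \<and> attain \<alpha> (average I f) r (average I (payoff \<alpha> I r f)))"
  using assms
proof (induction N arbitrary: I a b)
  case 0
  then obtain k where k: "\<And>x. x \<in> I \<Longrightarrow> f x = k"
    by (auto simp: steps_def constant_on_def)
  note I = \<open>spans I a b\<close>
  let ?v = "\<lambda>r. c_zero \<alpha> powr \<alpha> * r powr (\<alpha> / 2) - \<bar>k\<bar> powr \<alpha>"
  have v: "payoff \<alpha> I r f x = ?v r" if "x \<in> I" for r x
    using const_square(2)[of I a b x f k] I that k by blast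
  have "set_integrable lborel I f"
    using spans_integrable_const[OF I, of k] k by (subst set_integrable_cong[OF refl refl]) auto
  moreover have "set_integrable lborel I (payoff \<alpha> I r f)" for r
    using spans_integrable_const[OF I, of "?v r"] v by (subst set_integrable_cong[OF refl refl]) auto
  moreover have "average I f = k" "average I (payoff \<alpha> I r f) = ?v r" for r
    using average_const[OF I] k v by blast+
  ultimately show ?case
    using const_square(1)[OF I _ k] attain.leaf[of \<alpha> k] by simp
next
  case (Suc N)
  let ?L = "left_half I" and ?R = "right_half I"
  note I = \<open>spans I a b\<close>
  \<comment> \<open>With this sign the right half has mean \<open>average I f + d\<close> and the
    left half \<open>average I f - d\<close>.\<close>
  define d where "d = (average ?R f - average ?L f) / 2"
  note L = Suc.IH[OF spans_left[OF I]] and R = Suc.IH[OF spans_right[OF I]]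
  have st: "steps N ?L f" "steps N ?R f"
    using Suc.prems(2) by (simp_all add: steps_Suc)
  have int: "set_integrable lborel ?L f" "set_integrable lborel ?R f"
    using L R st by auto
  have sum: "square_summable H f x" if "H = ?L \<or> H = ?R" "x \<in> H" for H x
    using that L R st by blast
  note sq = square_halves[OF I _ _ int sum]
  have pay: "payoff \<alpha> I r f x = payoff \<alpha> H (r + d\<^sup>2) f x" if "H = ?L \<or> H = ?R" "x \<in> H" for H x r
    unfolding d_def using sq(2) that by blast
  have pint: "set_integrable lborel H (payoff \<alpha> I r f)" if "H = ?L \<or> H = ?R" for H r
  proof -
    have "set_integrable lborel H (payoff \<alpha> H (r + d\<^sup>2) f)"
      using that L R st by blast
    then show ?thesis
      using pay[OF that] by (subst set_integrable_cong[OF refl refl]) auto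
  qed
  have avg: "average I f = (average ?L f + average ?R f) / 2"
    by (rule average_halves[OF I int])
  have "attain \<alpha> (average I f) r (average I (payoff \<alpha> I r f))" for r
  proof -
    have "average H (payoff \<alpha> I r f) = average H (payoff \<alpha> H (r + d\<^sup>2) f)" if "H = ?L \<or> H = ?R" for H
      using pay[OF that] by (rule average_cong)
    then have "average I (payoff \<alpha> I r f) =
        (average ?R (payoff \<alpha> ?R (r + d\<^sup>2) f) + average ?L (payoff \<alpha> ?L (r + d\<^sup>2) f)) / 2"
      using average_halves[OF I pint pint, of r] by simp
    moreover have "average I f + d = average ?R f" "average I f - d = average ?L f"
      by (simp_all add: avg d_def field_simps)
    then have "attain \<alpha> (average I f) r
        ((average ?R (payoff \<alpha> ?R (r + d\<^sup>2) f) + average ?L (payoff \<alpha> ?L (r + d\<^sup>2) f)) / 2)"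
      using L R st attain.node[of \<alpha> "average I f" d r] by simp
    ultimately show ?thesis by (simp only:)
  qed
  moreover have "\<forall>x\<in>I. square_summable I f x"
    using sq(1) halves(1)[of I] by blast
  ultimately show ?case
    using integral_halves(1)[OF I int] integral_halves(1)[OF I pint pint] by blast
qed

text \<open>The converse construction: a node glues the functions found for its two subtrees, the
  one with mean p + a on the right half.\<close>

lemma attain_steps:
  assumes "attain \<alpha> p r v" "spans I a b"
  shows "\<exists>N f. steps N I f \<and> average I f = p \<and> average I (payoff \<alpha> I r f) = v"
  using assms
proof (induction arbitrary: I a b)
  case (leaf p r)
  have "average I (payoff \<alpha> I r (\<lambda>_. p)) = c_zero \<alpha> powr \<alpha> * r powr (\<alpha> / 2) - \<bar>p\<bar> powr \<alpha>"
    using const_square(2)[OF leaf] by (intro average_const[OF leaf]) auto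
  moreover have "steps 0 I (\<lambda>_. p)" "average I (\<lambda>_. p) = p"
    using average_const[OF leaf] by (auto simp: steps_def constant_on_def)
  ultimately show ?case by blast
next
  case (node p d r v w)
  let ?L = "left_half I" and ?R = "right_half I"
  note I = \<open>spans I a b\<close>
  note IL = spans_left[OF I] and IR = spans_right[OF I]
  obtain M g where g: "steps M ?R g" "average ?R g = p + d" "average ?R (payoff \<alpha> ?R (r + d\<^sup>2) g) = v"
    using node.IH(1)[OF IR] by blast
  obtain N h where h: "steps N ?L h" "average ?L h = p - d" "average ?L (payoff \<alpha> ?L (r + d\<^sup>2) h) = w"
    using node.IH(2)[OF IL] by blast
  define f where "f x = (if x \<in> ?L then h x else g x)" for x
  have fL: "f x = h x" if "x \<in> ?L" for x using that by (simp add: f_def)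
  have fR: "f x = g x" if "x \<in> ?R" for x using that halves(2)[of I] by (auto simp: f_def)
  \<comment> \<open>The two subtrees may differ in depth; both functions are also step functions at
    the larger depth.\<close>
  define K where "K = max M N"
  have st: "steps K ?L f" "steps K ?R f"
    using steps_mono[OF _ h(1), of K] steps_mono[OF _ g(1), of K]
    by (auto simp: K_def intro: steps_cong[OF IL fL] steps_cong[OF IR fR])
  then have fK: "steps (Suc K) I f" by (simp add: steps_Suc)
  have avL: "average ?L f = p - d" and avR: "average ?R f = p + d"
    using average_cong[of ?L f h] average_cong[of ?R f g] fL fR g(2) h(2) by auto
  note L = steps_attain[OF IL st(1), of \<alpha>] and R = steps_attain[OF IR st(2), of \<alpha>]
  have int: "set_integrable lborel ?L f" "set_integrable lborel ?R f"
    using L R by auto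
  have avI: "average I f = p"
    using average_halves[OF I int] avL avR by simp
  have pay: "payoff \<alpha> I r f x = payoff \<alpha> H (r + d\<^sup>2) f x" if "H = ?L \<or> H = ?R" "x \<in> H" for H x
  proof -
    have "square_summable H f x" using that L R by blast
    from square_halves(2)[OF I that int this, of \<alpha> r] show ?thesis
      by (simp add: avL avR)
  qed
  have pint: "set_integrable lborel H (payoff \<alpha> I r f)" if "H = ?L \<or> H = ?R" for H
  proof -
    have "set_integrable lborel H (payoff \<alpha> H (r + d\<^sup>2) f)"
      using that L R by blast
    then show ?thesis
      using pay[OF that] by (subst set_integrable_cong[OF refl refl]) auto
  qed
  have "average ?L (payoff \<alpha> I r f) = w"
    unfolding h(3)[symmetric] using pay[of ?L] payoff_cong[OF IL _ fL] by (intro average_cong) simp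
  moreover have "average ?R (payoff \<alpha> I r f) = v"
    unfolding g(3)[symmetric] using pay[of ?R] payoff_cong[OF IR _ fR] by (intro average_cong) simp
  ultimately have "average I (payoff \<alpha> I r f) = (v + w) / 2"
    using average_halves[OF I pint pint] by simp
  with fK avI show ?case by blast
qed

lemma bellman_attain:
  assumes "spans I a b"
  shows "bellman \<alpha> I p q = (SUP v \<in> {v. attain \<alpha> p (q\<^sup>2) v}. ereal v)"
proof -
  have "(\<lambda>f. average I (payoff \<alpha> I (q\<^sup>2) f)) ` {f \<in> test_functions I. average I f = p} = {v. attain \<alpha> p (q\<^sup>2) v}"
    using steps_attain[OF assms, of _ _ \<alpha>] attain_steps[OF _ assms]
    by (fastforce simp: test_functions_def steps_def)
  then have "{v. attain \<alpha> p (q\<^sup>2) v} = (\<lambda>f. average I (payoff \<alpha> I (q\<^sup>2) f)) ` {f \<in> test_functions I. average I f = p}"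
    by simp
  then show ?thesis
    unfolding bellman_def payoff_def[abs_def] by (simp add: image_image)
qed

lemma bounded_interval_spans:
  fixes I :: "real set"
  assumes "is_interval I" "bounded I" "interior I \<noteq> {}"
  shows "spans I (Inf I) (Sup I)"
proof -
  have bd: "bdd_below I" "bdd_above I"
    using assms(2) by (auto simp: bounded_imp_bdd_below bounded_imp_bdd_above)
  obtain x e where e: "0 < e" "ball x e \<subseteq> I"
    using assms(3) by (meson all_not_in_conv mem_interior)
  then have "x - e / 2 \<in> I" "x + e / 2 \<in> I" by (auto simp: subset_iff dist_real_def)
  then have "Inf I \<le> x - e / 2" "x + e / 2 \<le> Sup I"
    using bd by (auto intro: cInf_lower cSup_upper)
  then have "Inf I < Sup I" using e by linarith
  moreover have "y \<in> I" if y: "Inf I < y" "y < Sup I" for y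
  proof -
    obtain u v where "u \<in> I" "u < y" "v \<in> I" "y < v"
      using y bd \<open>x - e / 2 \<in> I\<close> by (metis cInf_less_iff empty_iff less_cSup_iff)
    then show ?thesis using assms(1) by (meson is_interval_1 less_imp_le)
  qed
  ultimately show ?thesis
    using bd by (auto simp: spans_def intro: cInf_lower cSup_upper)
qed

lemma sqrt_powr: "0 \<le> r \<Longrightarrow> sqrt r powr \<alpha> = r powr (\<alpha> / 2)"
  by (simp add: powr_powr flip: powr_half_sqrt)

text \<open>The obstacle and the splitting rule are homogeneous: p and a scale with l, r with l^2,
  and values with \<open>l powr \<alpha>\<close>. This reduces minimality to the case r = 1.\<close>

lemma attain_scale:
  assumes "attain \<alpha> p r v" "0 < l" "0 \<le> r"
  shows "attain \<alpha> (l * p) (l\<^sup>2 * r) (l powr \<alpha> * v)"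
  using assms
proof induction
  case (leaf p r)
  have "l\<^sup>2 powr (\<alpha> / 2) = l powr \<alpha>"
    using leaf sqrt_powr[of "l\<^sup>2" \<alpha>] by simp
  then have "l powr \<alpha> * (c_zero \<alpha> powr \<alpha> * r powr (\<alpha> / 2) - \<bar>p\<bar> powr \<alpha>) =
      c_zero \<alpha> powr \<alpha> * (l\<^sup>2 * r) powr (\<alpha> / 2) - \<bar>l * p\<bar> powr \<alpha>"
    using leaf by (simp add: powr_mult abs_mult algebra_simps)
  then show ?case
    by (simp add: attain.leaf)
next
  case (node p a r v w)
  then have "attain \<alpha> (l * p + l * a) (l\<^sup>2 * r + (l * a)\<^sup>2) (l powr \<alpha> * v)"
    "attain \<alpha> (l * p - l * a) (l\<^sup>2 * r + (l * a)\<^sup>2) (l powr \<alpha> * w)"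
    by (simp_all add: algebra_simps power_mult_distrib)
  from attain.node[OF this] show ?case
    by (simp add: distrib_left)
qed

subsection \<open>The first positive zero\<close>

lemma DERIV_If_same:
  fixes f g :: "real \<Rightarrow> real"
  assumes "(f has_real_derivative D) (at x)" "(g has_real_derivative D) (at x)" "f x = g x"
  shows "((\<lambda>y. if P y then f y else g y) has_real_derivative D) (at x)"
proof -
  have "((\<lambda>y. if P y then (f y - f x) / (y - x) else (g y - g x) / (y - x)) \<longlongrightarrow> D) (at x)"
    using assms unfolding has_field_derivative_iff
    by (intro filterlim_If) (erule filterlim_mono[OF _ order_refl inf_le1])+
  moreover have "(if P y then (f y - f x) / (y - x) else (g y - g x) / (y - x)) =
      ((if P y then f y else g y) - (if P x then f x else g x)) / (y - x)" for y
    using assms(3) by simp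
  ultimately show ?thesis
    unfolding has_field_derivative_iff by simp
qed

lemma has_real_derivative_abs_powr:
  assumes "x \<noteq> 0"
  shows "((\<lambda>x. \<bar>x\<bar> powr a) has_real_derivative a * \<bar>x\<bar> powr (a - 1) * sgn x) (at x)"
proof (cases "x > 0")
  case True
  then have "((\<lambda>x. x powr a) has_real_derivative a * \<bar>x\<bar> powr (a - 1) * sgn x) (at x)"
    by (auto intro!: derivative_eq_intros simp: powr_diff)
  then show ?thesis
    by (rule has_field_derivative_transform_within_open[of _ _ _ "{0<..}"]) (use True in auto)
next
  case False
  with assms have "((\<lambda>x. (- x) powr a) has_real_derivative a * \<bar>x\<bar> powr (a - 1) * sgn x) (at x)"
    by (auto intro!: derivative_eq_intros simp: powr_diff)
  then show ?thesis
    by (rule has_field_derivative_transform_within_open[of _ _ _ "{..<0}"]) (use False assms in auto)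
qed

text \<open>As a function of the right end point x, the error has derivative (g y - g x + (x - y) g'
  x) / 2. By convexity of g, the value g y lies above the tangent at x, so the error increases from
  0.\<close>

lemma trapezoid_convex:
  fixes G g g' :: "real \<Rightarrow> real"
  assumes "y \<le> z"
    and G: "\<And>x. y \<le> x \<Longrightarrow> x \<le> z \<Longrightarrow> (G has_real_derivative g x) (at x)"
    and g: "\<And>x. y \<le> x \<Longrightarrow> x \<le> z \<Longrightarrow> (g has_real_derivative g' x) (at x)"
    and g': "\<And>x w. y \<le> x \<Longrightarrow> x \<le> w \<Longrightarrow> w \<le> z \<Longrightarrow> g' x \<le> g' w"
  shows "G z - G y \<le> (z - y) * (g y + g z) / 2"
proof -
  have "(y - y) * (g y + g y) / 2 - G y \<le> (z - y) * (g y + g z) / 2 - G z"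
  proof (rule DERIV_nonneg_imp_nondecreasing[OF \<open>y \<le> z\<close>])
    fix x assume x: "y \<le> x" "x \<le> z"
    have "g x - x * g' x \<le> g y - y * g' x"
    proof (rule DERIV_nonpos_imp_nonincreasing[OF \<open>y \<le> x\<close>])
      fix w assume w: "y \<le> w" "w \<le> x"
      then have "((\<lambda>w. g w - w * g' x) has_real_derivative g' w - g' x) (at w)"
        using x by (auto intro!: derivative_eq_intros g)
      with g'[of w x] w x show "\<exists>D. ((\<lambda>w. g w - w * g' x) has_real_derivative D) (at w) \<and> D \<le> 0"
        by (intro exI[of _ "g' w - g' x"]) simp
    qed
    then have "0 \<le> (g y + g x) / 2 + (x - y) * g' x / 2 - g x"
      by (simp add: field_simps)
    moreover have "((\<lambda>x. (x - y) * (g y + g x) / 2 - G x) has_real_derivative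
        (g y + g x) / 2 + (x - y) * g' x / 2 - g x) (at x)"
      by (rule derivative_eq_intros G g x refl | simp)+
    ultimately show "\<exists>D. ((\<lambda>x. (x - y) * (g y + g x) / 2 - G x) has_real_derivative D) (at x) \<and> 0 \<le> D"
      by blast
  qed
  then show ?thesis
    by simp
qed

text \<open>A function homogeneous under the scaling above has the form
  \<open>r powr (\<alpha> / 2) * w (p / sqrt r)\<close>; its sum over the two children of a
  splitting is differentiated in the increment a. The profile w is general because the formula
  serves both for u and for the subsolution N_\<alpha> + \<epsilon>.\<close>

lemma slice_derivative:
  fixes w w' :: "real \<Rightarrow> real" and \<alpha> p t a :: real
  assumes w: "\<And>x. (w has_real_derivative w' x) (at x)"
    and pos: "0 < t + a\<^sup>2"
  defines "T \<equiv> sqrt (t + a\<^sup>2)"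
  defines "y \<equiv> (p - a) / T" and "z \<equiv> (p + a) / T"
  shows "((\<lambda>a. sqrt (t + a\<^sup>2) powr \<alpha> * (w ((p + a) / sqrt (t + a\<^sup>2)) + w ((p - a) / sqrt (t + a\<^sup>2))))
    has_real_derivative T powr (\<alpha> - 1) *
      (w' z - w' y + (z - y) * ((\<alpha> * w z - z * w' z) / 2 + (\<alpha> * w y - y * w' y) / 2))) (at a)"
proof -
  have T: "0 < T" using pos by (simp add: T_def)
  have T': "((\<lambda>a. sqrt (t + a\<^sup>2)) has_real_derivative a / T) (at a)"
  proof -
    have "((\<lambda>a. t + a\<^sup>2) has_real_derivative 2 * a) (at a)"
      by (rule derivative_eq_intros refl | simp)+
    from DERIV_chain2[OF DERIV_real_sqrt[OF pos] this] show ?thesis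
      by (simp add: T_def field_simps)
  qed
  have "((\<lambda>a. (p + a) / sqrt (t + a\<^sup>2)) has_real_derivative (1 * T - (p + a) * (a / T)) / (T * T)) (at a)"
    using T unfolding T_def by (intro DERIV_divide T'[unfolded T_def]) (auto intro!: derivative_eq_intros)
  moreover have "(1 * T - (p + a) * (a / T)) / (T * T) = (1 - z * (a / T)) / T"
    using T by (simp add: z_def divide_simps)
  ultimately have z': "((\<lambda>a. (p + a) / sqrt (t + a\<^sup>2)) has_real_derivative (1 - z * (a / T)) / T) (at a)"
    by simp
  have "((\<lambda>a. (p - a) / sqrt (t + a\<^sup>2)) has_real_derivative (- 1 * T - (p - a) * (a / T)) / (T * T)) (at a)"
    using T unfolding T_def by (intro DERIV_divide T'[unfolded T_def]) (auto intro!: derivative_eq_intros)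
  moreover have "(- 1 * T - (p - a) * (a / T)) / (T * T) = (- 1 - y * (a / T)) / T"
    using T by (simp add: y_def divide_simps)
  ultimately have y': "((\<lambda>a. (p - a) / sqrt (t + a\<^sup>2)) has_real_derivative (- 1 - y * (a / T)) / T) (at a)"
    by simp
  have wz: "((\<lambda>a. w ((p + a) / sqrt (t + a\<^sup>2))) has_real_derivative w' z * ((1 - z * (a / T)) / T)) (at a)"
    using DERIV_chain2[OF w z'] by (simp add: z_def T_def)
  have wy: "((\<lambda>a. w ((p - a) / sqrt (t + a\<^sup>2))) has_real_derivative w' y * ((- 1 - y * (a / T)) / T)) (at a)"
    using DERIV_chain2[OF w y'] by (simp add: y_def T_def)
  have pw: "((\<lambda>a. sqrt (t + a\<^sup>2) powr \<alpha>) has_real_derivative \<alpha> * T powr (\<alpha> - 1) * (a / T)) (at a)"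
    using DERIV_chain2[OF has_real_derivative_powr T', of \<alpha>] T by (simp add: T_def)
  \<comment> \<open>This eliminates a: apart from a positive factor, the derivative depends on y and
    z only.\<close>
  have e: "a / T = (z - y) / 2"
    by (simp add: z_def y_def flip: diff_divide_distrib)
  have pT: "T powr \<alpha> = T powr (\<alpha> - 1) * T"
    using T by (simp add: powr_diff)
  show ?thesis
    using DERIV_mult[OF pw DERIV_add[OF wz wy]]
  proof (rule DERIV_cong)
    have "w' z * ((1 - z * (a / T)) / T) + w' y * ((- 1 - y * (a / T)) / T) =
        (w' z * (1 - z * (a / T)) + w' y * (- 1 - y * (a / T))) / T"
      by (simp add: add_divide_distrib)
    then show "\<alpha> * T powr (\<alpha> - 1) * (a / T) *
        (w ((p + a) / sqrt (t + a\<^sup>2)) + w ((p - a) / sqrt (t + a\<^sup>2))) +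
        (w' z * ((1 - z * (a / T)) / T) + w' y * ((- 1 - y * (a / T)) / T)) * sqrt (t + a\<^sup>2) powr \<alpha> =
      T powr (\<alpha> - 1) * (w' z - w' y + (z - y) * ((\<alpha> * w z - z * w' z) / 2 + (\<alpha> * w y - y * w' y) / 2))"
      unfolding e using T by (simp add: pT flip: T_def z_def y_def) (simp add: field_simps)
  qed
qed

section \<open>The zero c and the signs of the functions N_\<beta> on [-c, c]\<close>

locale square_exponent =
  fixes \<alpha> :: real
  assumes \<alpha>: "2 \<le> \<alpha>"
begin

abbreviation (input) "c \<equiv> c_zero \<alpha>"
text \<open>The factor for which \<kappa> N_\<alpha> and
  \<open>c powr \<alpha> - x powr \<alpha>\<close>, both zero at c, also have equal slopes
  there.\<close>

definition \<kappa> :: real where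
  "\<kappa> = - (\<alpha> * c_zero \<alpha> powr (\<alpha> - 1) / deriv (Nfun \<alpha>) (c_zero \<alpha>))"

text \<open>N_2 = 1 - x^2 vanishes at 1, so by Sturm comparison N_\<alpha> cannot stay positive on
  [0, 1].\<close>

lemma c_zero: "0 < c" "c \<le> 1" "Nfun \<alpha> c = 0" "0 \<le> x \<Longrightarrow> x < c \<Longrightarrow> 0 < Nfun \<alpha> x"
proof -
  have "\<exists>x. 0 \<le> x \<and> x \<le> 1 \<and> Nfun \<alpha> x \<le> 0"
  proof (rule ccontr)
    assume neg: "\<not> ?thesis"
    have "0 < Nfun 2 1"
    proof (rule Nfun_sturm[OF \<alpha>])
      show "0 < Nfun \<alpha> x" if "0 \<le> x" "x \<le> 1" for x
        using neg that by (meson not_le)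
    qed simp
    then show False by (simp add: Nfun_2)
  qed
  then obtain b where b: "0 \<le> b" "b \<le> 1" "Nfun \<alpha> b \<le> 0" by blast
  then obtain d where d: "0 < d" "d \<le> b" "Nfun \<alpha> d = 0" "\<And>x. 0 \<le> x \<Longrightarrow> x < d \<Longrightarrow> 0 < Nfun \<alpha> x"
    using least_zero[of 0 b "Nfun \<alpha>", OF continuous_on_Nfun _ b(3,1)] Nfun_0 zero_less_one by metis
  have "c = d"
    unfolding c_zero_def
  proof (rule Least_equality)
    show "d \<le> y" if "0 < y \<and> Nfun \<alpha> y = 0" for y
      using that d(4)[of y] by (cases "d \<le> y") auto
  qed (use d in simp)
  then show "0 < c" "c \<le> 1" "Nfun \<alpha> c = 0" "0 \<le> x \<Longrightarrow> x < c \<Longrightarrow> 0 < Nfun \<alpha> x"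
    using b d by auto
qed

lemma Nfun_nonneg:
  assumes "\<beta> \<le> \<alpha>" "\<bar>x\<bar> \<le> c"
  shows "0 \<le> Nfun \<beta> x"
proof -
  have pos: "0 < Nfun \<beta> x" if "0 \<le> x" "x < c" for x
    using Nfun_sturm[OF \<open>\<beta> \<le> \<alpha>\<close> that(1)] c_zero(4) that(2) by (meson le_less_trans)
  have "0 \<le> Nfun \<beta> x" if "0 \<le> x" "x \<le> c" for x
  proof (rule continuous_ge_on_closure[of "{0<..<c}" "Nfun \<beta>" x 0])
    show "continuous_on (closure {0<..<c}) (Nfun \<beta>)"
      by (rule continuous_on_Nfun)
    show "x \<in> closure {0<..<c}"
      using that c_zero(1) by simp
    show "0 \<le> Nfun \<beta> y" if "y \<in> {0<..<c}" for y
      using pos[of y] that by simp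
  qed
  from this[of "\<bar>x\<bar>"] assms show ?thesis
    by (cases "0 \<le> x") (auto simp: Nfun_minus)
qed

lemma deriv_Nfun_nonpos:
  assumes "0 \<le> \<beta>" "\<beta> \<le> \<alpha>" "0 \<le> x" "x \<le> c"
  shows "deriv (Nfun \<beta>) x \<le> 0"
proof -
  have "deriv (Nfun \<beta>) x \<le> deriv (Nfun \<beta>) 0"
  proof (rule DERIV_nonpos_imp_nonincreasing[OF \<open>0 \<le> x\<close>])
    fix y assume "0 \<le> y" "y \<le> x"
    then show "\<exists>D. (deriv (Nfun \<beta>) has_real_derivative D) (at y) \<and> D \<le> 0"
      using assms Nfun_nonneg[of "\<beta> - 2" y]
      by (intro exI[of _ "- \<beta> * Nfun (\<beta> - 2) y"] conjI has_derivative_deriv_Nfun) auto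
  qed
  then show ?thesis
    by (simp add: deriv_Nfun_0)
qed

lemma Nfun_antimono:
  assumes "0 \<le> \<beta>" "\<beta> \<le> \<alpha>" "0 \<le> x" "x \<le> y" "y \<le> c"
  shows "Nfun \<beta> y \<le> Nfun \<beta> x"
proof (rule DERIV_nonpos_imp_nonincreasing[OF \<open>x \<le> y\<close>])
  fix z assume "x \<le> z" "z \<le> y"
  then show "\<exists>D. (Nfun \<beta> has_real_derivative D) (at z) \<and> D \<le> 0"
    using assms by (intro exI[of _ "deriv (Nfun \<beta>) z"] conjI has_derivative_Nfun deriv_Nfun_nonpos) auto
qed

text \<open>The convex function \<open>N'\<close> lies above its tangent at \<open>c\<close>; integrate over \<open>[0, c]\<close>.\<close>
lemma deriv_Nfun_c: "1 \<le> - deriv (Nfun \<alpha>) c * (c * (1 - c\<^sup>2 / 2))"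
proof -
  let ?n = "deriv (Nfun \<alpha>) c"
  \<comment> \<open>Since N_\<alpha>(c) = 0, the differential equation reads N''(c) = c N'(c), which
    is the slope of the tangent to N' at c.\<close>
  have c: "- \<alpha> * Nfun (\<alpha> - 2) c = c * ?n"
    using Nfun_ode[of \<alpha> c] by (simp add: c_zero(3))
  have tangent: "?n + c * ?n * (x - c) \<le> deriv (Nfun \<alpha>) x" if "0 \<le> x" "x \<le> c" for x
  proof -
    have "deriv (Nfun \<alpha>) c - c * ?n * c \<le> deriv (Nfun \<alpha>) x - c * ?n * x"
    proof (rule DERIV_nonpos_imp_nonincreasing[OF \<open>x \<le> c\<close>])
      fix y assume y: "x \<le> y" "y \<le> c"
      have "\<alpha> * Nfun (\<alpha> - 2) c \<le> \<alpha> * Nfun (\<alpha> - 2) y"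
        using y that \<alpha> by (intro mult_left_mono Nfun_antimono) auto
      then have "- \<alpha> * Nfun (\<alpha> - 2) y - c * ?n \<le> 0"
        using c by simp
      moreover have "((\<lambda>x. deriv (Nfun \<alpha>) x - c * ?n * x) has_real_derivative
          - \<alpha> * Nfun (\<alpha> - 2) y - c * ?n) (at y)"
        by (rule derivative_eq_intros has_derivative_deriv_Nfun refl | simp)+
      ultimately show "\<exists>D. ((\<lambda>x. deriv (Nfun \<alpha>) x - c * ?n * x) has_real_derivative D) (at y) \<and> D \<le> 0"
        by blast
    qed
    then show ?thesis by (simp add: algebra_simps)
  qed
  define f where "f x = Nfun \<alpha> x - ?n * (x - c) - c * ?n * (x - c)\<^sup>2 / 2" for x
  have "f 0 \<le> f c"
  proof (rule DERIV_nonneg_imp_nondecreasing[of 0 c f])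
    fix x assume "0 \<le> x" "x \<le> c"
    moreover have "(f has_real_derivative deriv (Nfun \<alpha>) x - ?n - c * ?n * (x - c)) (at x)"
      unfolding f_def by (rule derivative_eq_intros has_derivative_Nfun refl | simp)+
    ultimately show "\<exists>D. (f has_real_derivative D) (at x) \<and> 0 \<le> D"
      using tangent[of x] by (intro exI[of _ "deriv (Nfun \<alpha>) x - ?n - c * ?n * (x - c)"]) simp
  qed (use c_zero(1) in simp)
  then show ?thesis
    by (simp add: f_def Nfun_0 c_zero(3) power2_eq_square algebra_simps)
qed

lemma deriv_Nfun_c_neg: "deriv (Nfun \<alpha>) c < 0"
proof -
  have "deriv (Nfun \<alpha>) c \<le> 0"
    using deriv_Nfun_nonpos[of \<alpha> c] \<alpha> c_zero(1) by simp
  with deriv_Nfun_c show ?thesis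
    by (cases "deriv (Nfun \<alpha>) c = 0") auto
qed

lemma \<kappa>_pos: "0 < \<kappa>"
  using \<alpha> c_zero(1) deriv_Nfun_c_neg by (simp add: \<kappa>_def divide_pos_neg)

lemma \<kappa>_deriv: "\<kappa> * deriv (Nfun \<alpha>) c = - \<alpha> * c powr (\<alpha> - 1)"
  using deriv_Nfun_c_neg by (simp add: \<kappa>_def)

text \<open>For \<open>slice_antimono\<close>. By \<open>deriv_Nfun_c\<close>, \<kappa> is at most
  \<open>\<alpha> * c powr (\<alpha> - 2)\<close> times y (1 - y / 2) with y = c^2, and that product
  is at most 1 / 2. With c \<le> 1 it remains to see \<alpha> / 2 + 1 \<le> 2 (\<alpha> - 1), which
  holds for \<alpha> \<ge> 2.\<close>

lemma \<kappa>_bound: "\<kappa> + c powr \<alpha> \<le> 2 * (\<alpha> - 1) * c powr (\<alpha> - 2)"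
proof -
  let ?s = "- deriv (Nfun \<alpha>) c" and ?y = "c\<^sup>2"
  have s: "0 < ?s" using deriv_Nfun_c_neg by simp
  have pow: "c powr (\<alpha> - 1) = c * c powr (\<alpha> - 2)" "c powr \<alpha> = ?y * c powr (\<alpha> - 2)"
    using c_zero(1) by (simp_all add: powr_diff power2_eq_square)
  have "\<kappa> = \<alpha> * (c * (1 / ?s)) * c powr (\<alpha> - 2)"
    by (simp add: \<kappa>_def pow(1))
  also have "1 / ?s \<le> c * (1 - ?y / 2)"
    using deriv_Nfun_c s by (simp add: field_simps)
  then have "\<alpha> * (c * (1 / ?s)) * c powr (\<alpha> - 2) \<le> \<alpha> * (c * (c * (1 - ?y / 2))) * c powr (\<alpha> - 2)"
    using \<alpha> c_zero(1) by (intro mult_right_mono mult_left_mono) auto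
  also have "c * (c * (1 - ?y / 2)) = 1 / 2 - (1 - ?y)\<^sup>2 / 2"
    by (simp add: power2_eq_square field_simps)
  also have "\<alpha> * (1 / 2 - (1 - ?y)\<^sup>2 / 2) * c powr (\<alpha> - 2) \<le> \<alpha> * (1 / 2) * c powr (\<alpha> - 2)"
    using \<alpha> by (intro mult_right_mono mult_left_mono) auto
  finally have "\<kappa> + c powr \<alpha> \<le> (\<alpha> / 2 + ?y) * c powr (\<alpha> - 2)"
    unfolding pow by (simp add: algebra_simps)
  also have "\<dots> \<le> 2 * (\<alpha> - 1) * c powr (\<alpha> - 2)"
    using \<alpha> c_zero(1,2) power_le_one[of c 2] by (intro mult_right_mono) auto
  finally show ?thesis .
qed

subsection \<open>The candidate is a supersolution\<close>

definition u_deriv :: "real \<Rightarrow> real" where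
  "u_deriv x = (if \<bar>x\<bar> \<le> c then \<kappa> * deriv (Nfun \<alpha>) x else - (\<alpha> * \<bar>x\<bar> powr (\<alpha> - 1) * sgn x))"

lemma deriv_Nfun_abs_c: "\<bar>x\<bar> = c \<Longrightarrow> \<kappa> * deriv (Nfun \<alpha>) x = - (\<alpha> * \<bar>x\<bar> powr (\<alpha> - 1) * sgn x)"
  using \<kappa>_deriv c_zero(1) deriv_Nfun_minus[of \<alpha> c] by (cases "x = c"; cases "x = - c") auto

lemma Nfun_abs_c: "\<bar>x\<bar> = c \<Longrightarrow> Nfun \<alpha> x = 0"
  using c_zero(3) Nfun_minus[of \<alpha> c] by (cases "x = c"; cases "x = - c") auto

lemma u_inside: "\<bar>x\<bar> \<le> c \<Longrightarrow> u_fun \<alpha> x = \<kappa> * Nfun \<alpha> x"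
  by (simp add: u_fun_def \<kappa>_def)

lemma u_outside: "c \<le> \<bar>x\<bar> \<Longrightarrow> u_fun \<alpha> x = c powr \<alpha> - \<bar>x\<bar> powr \<alpha>"
  using Nfun_abs_c[of x] by (auto simp: u_fun_def)

lemma u_deriv_outside: "c \<le> \<bar>x\<bar> \<Longrightarrow> u_deriv x = - (\<alpha> * \<bar>x\<bar> powr (\<alpha> - 1) * sgn x)"
  using deriv_Nfun_abs_c[of x] by (cases "\<bar>x\<bar> = c") (simp_all add: u_deriv_def)

lemma u_even: "u_fun \<alpha> (- x) = u_fun \<alpha> x"
  by (simp add: u_fun_def Nfun_minus)

lemma u_deriv_odd: "u_deriv (- x) = - u_deriv x"
  by (simp add: u_deriv_def deriv_Nfun_minus sgn_minus)

lemma has_derivative_u: "(u_fun \<alpha> has_real_derivative u_deriv x) (at x)"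
proof -
  let ?f = "\<lambda>x. \<kappa> * Nfun \<alpha> x" and ?g = "\<lambda>x. c powr \<alpha> - \<bar>x\<bar> powr \<alpha>"
  have f: "(?f has_real_derivative \<kappa> * deriv (Nfun \<alpha>) x) (at x)"
    by (intro DERIV_cmult has_derivative_Nfun)
  have g: "(?g has_real_derivative - (\<alpha> * \<bar>x\<bar> powr (\<alpha> - 1) * sgn x)) (at x)" if "x \<noteq> 0"
    using DERIV_diff[OF DERIV_const has_real_derivative_abs_powr[OF that]] by simp
  have u: "u_fun \<alpha> = (\<lambda>x. if \<bar>x\<bar> \<le> c then ?f x else ?g x)"
    by (simp add: u_fun_def \<kappa>_def fun_eq_iff)
  consider "\<bar>x\<bar> < c" | "c < \<bar>x\<bar>" | "\<bar>x\<bar> = c" by linarith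
  then show ?thesis
  proof cases
    case 1
    then have "(?f has_real_derivative u_deriv x) (at x)"
      using f by (simp add: u_deriv_def)
    then show ?thesis
      by (rule has_field_derivative_transform_within_open[of _ _ _ "{-c<..<c}"]) (use 1 in \<open>auto simp: u_inside\<close>)
  next
    case 2
    then have "(?g has_real_derivative u_deriv x) (at x)"
      using g c_zero(1) by (auto simp: u_deriv_def)
    then show ?thesis
      by (rule has_field_derivative_transform_within_open[of _ _ _ "- {-c..c}"]) (use 2 in \<open>auto simp: u_outside\<close>)
  next
    case 3
    then have "x \<noteq> 0"
      using c_zero(1) by auto
    \<comment> \<open>Points near x fall on both branches, but these agree at x in value and in
      slope.\<close>
    have "(u_fun \<alpha> has_real_derivative \<kappa> * deriv (Nfun \<alpha>) x) (at x)"
      unfolding u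
    proof (rule DERIV_If_same[OF f])
      show "(?g has_real_derivative \<kappa> * deriv (Nfun \<alpha>) x) (at x)"
        unfolding deriv_Nfun_abs_c[OF 3] by (rule g[OF \<open>x \<noteq> 0\<close>])
      show "?f x = ?g x"
        using 3 Nfun_abs_c[OF 3] by simp
    qed
    with 3 show ?thesis
      by (simp add: u_deriv_def)
  qed
qed

text \<open>The derivative of \<open>t powr (\<alpha> / 2) * u (x / sqrt t)\<close> with respect to \<open>t\<close> at \<open>t = 1\<close>.\<close>
definition u_time :: "real \<Rightarrow> real" where
  "u_time x = (\<alpha> * u_fun \<alpha> x - x * u_deriv x) / 2"

lemma u_time_inside: "\<bar>x\<bar> \<le> c \<Longrightarrow> u_time x = \<kappa> * (\<alpha> * Nfun (\<alpha> - 2) x) / 2"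
proof -
  assume x: "\<bar>x\<bar> \<le> c"
  have "\<alpha> * Nfun (\<alpha> - 2) x = \<alpha> * Nfun \<alpha> x - x * deriv (Nfun \<alpha>) x"
    using Nfun_ode[of \<alpha> x] by simp
  with x show ?thesis
    by (simp add: u_time_def u_inside u_deriv_def right_diff_distrib mult_ac)
qed

text \<open>Outside, the homogeneous extension is \<open>c powr \<alpha> * r powr (\<alpha> / 2) -
  \<bar>p\<bar> powr \<alpha>\<close>, whose derivative in r does not depend on p.\<close>

lemma u_time_outside: "c \<le> \<bar>x\<bar> \<Longrightarrow> u_time x = \<alpha> * c powr \<alpha> / 2"
proof -
  assume x: "c \<le> \<bar>x\<bar>"
  then have "0 < \<bar>x\<bar>" using c_zero(1) by linarith
  then have "x * (\<alpha> * \<bar>x\<bar> powr (\<alpha> - 1) * sgn x) = \<alpha> * \<bar>x\<bar> powr \<alpha>"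
    by (simp add: powr_diff sgn_if)
  with x show ?thesis
    by (simp add: u_time_def u_outside u_deriv_outside right_diff_distrib)
qed

lemma u_time_even: "u_time (- x) = u_time x"
  by (simp add: u_time_def u_even u_deriv_odd)

text \<open>Inside, N_(\<alpha>-2) is largest at 0; outside, the value is the one at c.\<close>

lemma u_time_le: "u_time x \<le> \<kappa> * \<alpha> / 2"
proof -
  have in_c: "u_time x \<le> \<kappa> * \<alpha> / 2" if "\<bar>x\<bar> \<le> c" for x
  proof -
    have "Nfun (\<alpha> - 2) \<bar>x\<bar> \<le> Nfun (\<alpha> - 2) 0"
      using that \<alpha> by (intro Nfun_antimono) auto
    then have "Nfun (\<alpha> - 2) x \<le> 1"
      using Nfun_minus[of "\<alpha> - 2" x] by (simp add: Nfun_0 abs_if split: if_splits)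
    then have "\<kappa> * (\<alpha> * Nfun (\<alpha> - 2) x) \<le> \<kappa> * (\<alpha> * 1)"
      using \<kappa>_pos \<alpha> by (intro mult_left_mono) auto
    with u_time_inside[OF that] show ?thesis by linarith
  qed
  show ?thesis
  proof (cases "\<bar>x\<bar> \<le> c")
    case False
    then have "u_time x = u_time c"
      using c_zero(1) by (simp add: u_time_outside)
    with in_c[of c] c_zero(1) show ?thesis by simp
  qed (rule in_c)
qed

section \<open>Sign of the derivative along a splitting\<close>

definition slice :: "real \<Rightarrow> real \<Rightarrow> real" where
  "slice y z = u_deriv z - u_deriv y + (z - y) * (u_time z + u_time y)"

lemma slice_swap: "slice (- z) (- y) = slice y z"
  by (simp add: slice_def u_deriv_odd u_time_even)

text \<open>Here \<open>u_time\<close> is - u'' / 2, so \<open>slice y z\<close> is the integral of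
  u'' minus its trapezoidal rule. The function u'' is convex because its second derivative is
  \<kappa> \<alpha> (\<alpha> - 2) N_(\<alpha>-4) \<ge> 0.\<close>

lemma slice_inside:
  assumes "y \<le> z" "- c \<le> y" "z \<le> c"
  shows "slice y z \<le> 0"
proof -
  let ?g = "\<lambda>x. - \<alpha> * Nfun (\<alpha> - 2) x" and ?g' = "\<lambda>x. - \<alpha> * deriv (Nfun (\<alpha> - 2)) x"
  have "deriv (Nfun \<alpha>) z - deriv (Nfun \<alpha>) y \<le> (z - y) * (?g y + ?g z) / 2"
  proof (rule trapezoid_convex[OF \<open>y \<le> z\<close>])
    show "(?g has_real_derivative ?g' x) (at x)" for x
      by (intro DERIV_cmult has_derivative_Nfun)
    show "?g' x \<le> ?g' w" if "y \<le> x" "x \<le> w" "w \<le> z" for x w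
    proof (rule DERIV_nonneg_imp_nondecreasing[OF \<open>x \<le> w\<close>])
      fix v assume "x \<le> v" "v \<le> w"
      then have "0 \<le> Nfun (\<alpha> - 2 - 2) v"
        using that assms by (intro Nfun_nonneg) auto
      then have "0 \<le> - \<alpha> * (- (\<alpha> - 2) * Nfun (\<alpha> - 2 - 2) v)"
        using \<alpha> by (simp add: zero_le_mult_iff mult_le_0_iff)
      then show "\<exists>D. (?g' has_real_derivative D) (at v) \<and> 0 \<le> D"
        using DERIV_cmult[OF has_derivative_deriv_Nfun, of "- \<alpha>" "\<alpha> - 2" v] by blast
    qed
  qed (rule has_derivative_deriv_Nfun)
  then have "\<kappa> * (deriv (Nfun \<alpha>) z - deriv (Nfun \<alpha>) y - (z - y) * (?g y + ?g z) / 2) \<le> 0"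
    using \<kappa>_pos by (intro mult_nonneg_nonpos) auto
  moreover have "slice y z = \<kappa> * (deriv (Nfun \<alpha>) z - deriv (Nfun \<alpha>) y - (z - y) * (?g y + ?g z) / 2)"
  proof -
    have "\<bar>y\<bar> \<le> c" "\<bar>z\<bar> \<le> c" using assms by auto
    then show ?thesis
      unfolding slice_def u_deriv_def by (simp add: u_time_inside) (simp add: field_simps)
  qed
  ultimately show ?thesis by linarith
qed

text \<open>Beyond c, \<open>u_time\<close> is constant, so the change has two parts. The slope of
  \<open>- u_deriv\<close> is at least
  \<open>\<alpha> * (\<alpha> - 1) * c powr (\<alpha> - 2)\<close> there, and
  \<open>\<kappa>_bound\<close> bounds \<open>u_time z + u_time y\<close> by the same
  number.\<close>

lemma slice_antimono:
  assumes "c \<le> x" "x \<le> z"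
  shows "slice y z \<le> slice y x"
proof -
  have "x powr (\<alpha> - 1) - (\<alpha> - 1) * c powr (\<alpha> - 2) * x \<le> z powr (\<alpha> - 1) - (\<alpha> - 1) * c powr (\<alpha> - 2) * z"
  proof (rule DERIV_nonneg_imp_nondecreasing[OF \<open>x \<le> z\<close>])
    fix v assume "x \<le> v" "v \<le> z"
    with assms have v: "c \<le> v" "0 < v" using c_zero(1) by linarith+
    have "((\<lambda>v. v powr (\<alpha> - 1) - (\<alpha> - 1) * c powr (\<alpha> - 2) * v) has_real_derivative
        (\<alpha> - 1) * v powr (\<alpha> - 1 - 1) - (\<alpha> - 1) * c powr (\<alpha> - 2)) (at v)"
      by (intro DERIV_diff has_real_derivative_powr v DERIV_cmult_Id)
    moreover have "c powr (\<alpha> - 2) \<le> v powr (\<alpha> - 1 - 1)"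
      using powr_mono2[of "\<alpha> - 2" c v] \<alpha> v c_zero(1) by simp
    then have "0 \<le> (\<alpha> - 1) * v powr (\<alpha> - 1 - 1) - (\<alpha> - 1) * c powr (\<alpha> - 2)"
      using \<alpha> by simp
    ultimately show "\<exists>D. ((\<lambda>v. v powr (\<alpha> - 1) - (\<alpha> - 1) * c powr (\<alpha> - 2) * v) has_real_derivative D) (at v) \<and> 0 \<le> D"
      by blast
  qed
  then have "\<alpha> * ((\<alpha> - 1) * c powr (\<alpha> - 2) * (z - x)) \<le> \<alpha> * (z powr (\<alpha> - 1) - x powr (\<alpha> - 1))"
    using \<alpha> by (intro mult_left_mono) (auto simp: algebra_simps)
  moreover have "u_time z + u_time y \<le> \<alpha> * (\<alpha> - 1) * c powr (\<alpha> - 2)"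
  proof -
    have "u_time z + u_time y \<le> \<alpha> * (\<kappa> + c powr \<alpha>) / 2"
      using u_time_le[of y] u_time_outside[of z] assms by (simp add: algebra_simps)
    also have "\<dots> \<le> \<alpha> * (2 * (\<alpha> - 1) * c powr (\<alpha> - 2)) / 2"
      using \<kappa>_bound \<alpha> by (intro divide_right_mono mult_left_mono) auto
    finally show ?thesis by (simp add: algebra_simps)
  qed
  then have "(z - x) * (u_time z + u_time y) \<le> (z - x) * (\<alpha> * (\<alpha> - 1) * c powr (\<alpha> - 2))"
    using assms by (intro mult_left_mono) auto
  moreover have "slice y z - slice y x =
      - (\<alpha> * (z powr (\<alpha> - 1) - x powr (\<alpha> - 1))) + (z - x) * (u_time z + u_time y)"
  proof -
    have "0 < x" "0 < z" "c \<le> \<bar>x\<bar>" "c \<le> \<bar>z\<bar>" using assms c_zero(1) by linarith+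
    then have "u_deriv x = - (\<alpha> * x powr (\<alpha> - 1))" "u_deriv z = - (\<alpha> * z powr (\<alpha> - 1))" "u_time x = u_time z"
      by (simp_all add: u_deriv_outside u_time_outside)
    then show ?thesis
      by (simp add: slice_def algebra_simps)
  qed
  ultimately show ?thesis
    by (simp add: mult_ac)
qed

text \<open>A point z beyond c is pulled back to c, or to y if y \<ge> c, where
  \<open>slice y y\<close> is 0. Reflection by \<open>slice_swap\<close> handles y below -c.\<close>

lemma slice_nonpos:
  assumes "y \<le> z"
  shows "slice y z \<le> 0"
proof -
  have right: "slice y z \<le> 0" if "- c \<le> y" "y \<le> z" for y z
  proof -
    consider "z \<le> c" | "y \<le> c" "c \<le> z" | "c \<le> y" by linarith
    then show ?thesis
    proof cases
      case 1 then show ?thesis using that slice_inside by simp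
    next
      case 2 then show ?thesis using that slice_antimono[of c z y] slice_inside[of y c] by simp
    next
      case 3 then show ?thesis using that slice_antimono[of y z y] by (simp add: slice_def)
    qed
  qed
  consider "- c \<le> y" | "z \<le> c" | "y \<le> - c" "c \<le> z" by linarith
  then show ?thesis
  proof cases
    case 2 then show ?thesis using assms right[of "- z" "- y"] by (simp add: slice_swap)
  next
    case 3
    then have "slice y c \<le> 0"
      using right[of "- c" "- y"] c_zero(1) by (simp add: slice_swap)
    then show ?thesis using 3 slice_antimono[of c z y] by simp
  qed (use right assms in simp)
qed

section \<open>U majorizes the obstacle and satisfies the splitting inequality\<close>

lemma U_pos: "0 < q \<Longrightarrow> U_fun \<alpha> p q = q powr \<alpha> * u_fun \<alpha> (p / q)"
  using u_even[of "p / q"] by (cases "0 \<le> p") (auto simp: U_fun_def)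

lemma U_outside:
  assumes "0 \<le> q" "c * q \<le> \<bar>p\<bar>"
  shows "U_fun \<alpha> p q = c powr \<alpha> * q powr \<alpha> - \<bar>p\<bar> powr \<alpha>"
proof (cases "q = 0")
  case False
  with assms have "0 < q" "c \<le> \<bar>p / q\<bar>"
    by (simp_all add: pos_le_divide_eq)
  then show ?thesis
    by (simp add: U_pos u_outside right_diff_distrib mult.commute flip: powr_mult)
qed (use assms in \<open>simp add: U_fun_def\<close>)

text \<open>Inside, \<open>\<kappa> * Nfun \<alpha> x + x powr \<alpha>\<close> decreases to
  \<open>c powr \<alpha>\<close> on [0, c]: since N'(y) / y increases, \<kappa> N'(y) is at most
  \<open>- \<alpha> * y * c powr (\<alpha> - 2)\<close>, hence at most
  \<open>- \<alpha> * y powr (\<alpha> - 1)\<close>.\<close>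

lemma obstacle_le_u: "c powr \<alpha> - \<bar>x\<bar> powr \<alpha> \<le> u_fun \<alpha> x"
proof (cases "\<bar>x\<bar> \<le> c")
  case True
  have "\<kappa> * Nfun \<alpha> c + c powr \<alpha> \<le> \<kappa> * Nfun \<alpha> \<bar>x\<bar> + \<bar>x\<bar> powr \<alpha>"
  proof (rule DERIV_nonpos_imp_decreasing_open[OF True])
    fix y assume "\<bar>x\<bar> < y" "y < c"
    then have y: "0 < y" "y \<le> c" by auto
    \<comment> \<open>The numerator w N'' - N' of the derivative of N' / w vanishes at 0 and has
      derivative w N''' \<ge> 0.\<close>
    have ratio: "deriv (Nfun \<alpha>) y / y \<le> deriv (Nfun \<alpha>) c / c"
    proof (rule DERIV_nonneg_imp_nondecreasing[OF y(2)])
      fix w assume w: "y \<le> w" "w \<le> c"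
      with y have "0 \<le> w" by simp
      have "0 * (- \<alpha> * Nfun (\<alpha> - 2) 0) - deriv (Nfun \<alpha>) 0 \<le> w * (- \<alpha> * Nfun (\<alpha> - 2) w) - deriv (Nfun \<alpha>) w"
      proof (rule DERIV_nonneg_imp_nondecreasing[OF \<open>0 \<le> w\<close>])
        fix v assume v: "0 \<le> v" "v \<le> w"
        have "((\<lambda>w. w * (- \<alpha> * Nfun (\<alpha> - 2) w) - deriv (Nfun \<alpha>) w) has_real_derivative
            - \<alpha> * (v * deriv (Nfun (\<alpha> - 2)) v)) (at v)"
          by (rule derivative_eq_intros has_derivative_Nfun has_derivative_deriv_Nfun refl | simp)+
        moreover have "deriv (Nfun (\<alpha> - 2)) v \<le> 0"
          using v w \<alpha> by (intro deriv_Nfun_nonpos) auto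
        then have "0 \<le> - \<alpha> * (v * deriv (Nfun (\<alpha> - 2)) v)"
          using v \<alpha> by (simp add: mult_le_0_iff)
        ultimately show "\<exists>D. ((\<lambda>w. w * (- \<alpha> * Nfun (\<alpha> - 2) w) - deriv (Nfun \<alpha>) w) has_real_derivative D) (at v) \<and> 0 \<le> D"
          by blast
      qed
      then have "0 \<le> (- \<alpha> * Nfun (\<alpha> - 2) w * w - deriv (Nfun \<alpha>) w * 1) / (w * w)"
        by (simp add: deriv_Nfun_0 mult.commute)
      moreover have "((\<lambda>y. deriv (Nfun \<alpha>) y / y) has_real_derivative
          (- \<alpha> * Nfun (\<alpha> - 2) w * w - deriv (Nfun \<alpha>) w * 1) / (w * w)) (at w)"
        using y w by (intro DERIV_divide has_derivative_deriv_Nfun DERIV_ident) auto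
      ultimately show "\<exists>D. ((\<lambda>y. deriv (Nfun \<alpha>) y / y) has_real_derivative D) (at w) \<and> 0 \<le> D"
        by blast
    qed
    have "\<kappa> * deriv (Nfun \<alpha>) y = \<kappa> * (deriv (Nfun \<alpha>) y / y) * y"
      using y by simp
    also have "\<dots> \<le> \<kappa> * (deriv (Nfun \<alpha>) c / c) * y"
      using y \<kappa>_pos ratio by (intro mult_right_mono mult_left_mono) auto
    also have "\<dots> = \<kappa> * deriv (Nfun \<alpha>) c / c * y"
      by simp
    also have "\<dots> = - (\<alpha> * (y * c powr (\<alpha> - 2)))"
      unfolding \<kappa>_deriv using c_zero(1) by (simp add: powr_diff field_simps power2_eq_square)
    also have "\<dots> \<le> - (\<alpha> * (y * y powr (\<alpha> - 2)))"
      using y \<alpha> powr_mono2[of "\<alpha> - 2" y c] by simp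
    also have "y * y powr (\<alpha> - 2) = y powr (\<alpha> - 1)"
      using y by (simp add: powr_diff field_simps power2_eq_square)
    finally have "\<kappa> * deriv (Nfun \<alpha>) y + \<alpha> * y powr (\<alpha> - 1) \<le> 0" by simp
    moreover have "((\<lambda>x. \<kappa> * Nfun \<alpha> x + x powr \<alpha>) has_real_derivative
        \<kappa> * deriv (Nfun \<alpha>) y + \<alpha> * y powr (\<alpha> - 1)) (at y)"
      using y by (intro DERIV_add DERIV_cmult has_derivative_Nfun has_real_derivative_powr)
    ultimately show "\<exists>D. ((\<lambda>x. \<kappa> * Nfun \<alpha> x + x powr \<alpha>) has_real_derivative D) (at y) \<and> D \<le> 0"
      by blast
  next
    show "continuous_on {\<bar>x\<bar>..c} (\<lambda>x. \<kappa> * Nfun \<alpha> x + x powr \<alpha>)"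
      using \<alpha> by (intro continuous_intros continuous_on_powr') auto
  qed
  moreover have "Nfun \<alpha> \<bar>x\<bar> = Nfun \<alpha> x"
    by (simp add: abs_if Nfun_minus)
  ultimately show ?thesis
    using True by (simp add: u_inside c_zero(3))
qed (simp add: u_outside)

lemma obstacle_le_U:
  assumes "0 \<le> q"
  shows "c powr \<alpha> * q powr \<alpha> - \<bar>p\<bar> powr \<alpha> \<le> U_fun \<alpha> p q"
proof (cases "q = 0")
  case False
  with assms have q: "0 < q" by simp
  have "q powr \<alpha> * (c powr \<alpha> - \<bar>p / q\<bar> powr \<alpha>) \<le> q powr \<alpha> * u_fun \<alpha> (p / q)"
    by (intro mult_left_mono obstacle_le_u) simp
  with q show ?thesis
    by (simp add: U_pos right_diff_distrib mult.commute flip: powr_mult)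
qed (simp add: U_outside)

text \<open>The comparison starts at b instead of 0 so that t = 0 is allowed when b > 0; the
  derivative formula needs t + b^2 > 0.\<close>

lemma U_slice_antimono:
  assumes "0 \<le> b" "b \<le> a" "0 < t + b\<^sup>2"
  shows "U_fun \<alpha> (p + a) (sqrt (t + a\<^sup>2)) + U_fun \<alpha> (p - a) (sqrt (t + a\<^sup>2))
    \<le> U_fun \<alpha> (p + b) (sqrt (t + b\<^sup>2)) + U_fun \<alpha> (p - b) (sqrt (t + b\<^sup>2))"
proof -
  let ?g = "\<lambda>a. sqrt (t + a\<^sup>2) powr \<alpha> *
    (u_fun \<alpha> ((p + a) / sqrt (t + a\<^sup>2)) + u_fun \<alpha> ((p - a) / sqrt (t + a\<^sup>2)))"
  have pos: "0 < t + e\<^sup>2" if "b \<le> e" for e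
    using assms that power_mono[of b e 2] by linarith
  have "?g a \<le> ?g b"
  proof (rule DERIV_nonpos_imp_nonincreasing[OF \<open>b \<le> a\<close>])
    fix e assume e: "b \<le> e" "e \<le> a"
    define T where "T = sqrt (t + e\<^sup>2)"
    have "(?g has_real_derivative T powr (\<alpha> - 1) * slice ((p - e) / T) ((p + e) / T)) (at e)"
      using slice_derivative[OF has_derivative_u pos[OF e(1)], of \<alpha> p]
      by (simp add: slice_def u_time_def T_def)
    moreover have "slice ((p - e) / T) ((p + e) / T) \<le> 0"
      using e assms by (intro slice_nonpos divide_right_mono) (auto simp: T_def pos less_imp_le)
    then have "T powr (\<alpha> - 1) * slice ((p - e) / T) ((p + e) / T) \<le> 0"
      by (simp add: mult_nonneg_nonpos)
    ultimately show "\<exists>D. (?g has_real_derivative D) (at e) \<and> D \<le> 0"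
      by blast
  qed
  with pos[of a] pos[of b] assms show ?thesis
    by (simp add: U_pos distrib_left)
qed

lemma U_node_nonneg:
  assumes "0 \<le> t" "0 \<le> a"
  shows "U_fun \<alpha> (p + a) (sqrt (t + a\<^sup>2)) + U_fun \<alpha> (p - a) (sqrt (t + a\<^sup>2)) \<le> 2 * U_fun \<alpha> p (sqrt t)"
proof -
  let ?g = "\<lambda>a. U_fun \<alpha> (p + a) (sqrt (t + a\<^sup>2)) + U_fun \<alpha> (p - a) (sqrt (t + a\<^sup>2))"
  consider "0 < t" | "a = 0" | "t = 0" "0 < a"
    using assms by linarith
  then show ?thesis
  proof cases
    case 1 then show ?thesis using U_slice_antimono[of 0 a t p] assms by simp
  next
    case 3
    \<comment> \<open>For t = 0 the comparison is made with a small increment b, for which both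
      children lie where U equals the obstacle; then b tends to 0.\<close>
    let ?e = "\<lambda>b. 2 * (c powr \<alpha> * b powr \<alpha>) - \<bar>p + b\<bar> powr \<alpha> - \<bar>p - b\<bar> powr \<alpha>"
    \<comment> \<open>For b < d both |p + b| and |p - b| are at least b, hence at least c b because
      c \<le> 1.\<close>
    define d where "d = (if p = 0 then a else min a (\<bar>p\<bar> / 2))"
    have "0 < d" using 3 by (simp add: d_def)
    have "?g a \<le> ?e b" if "0 < b" "b < d" for b
    proof -
      have "c * b \<le> b" using that c_zero by simp
      moreover have "b \<le> \<bar>p + b\<bar>" "b \<le> \<bar>p - b\<bar>"
        using that by (auto simp: d_def abs_if split: if_splits)
      ultimately have far: "c * b \<le> \<bar>p + b\<bar>" "c * b \<le> \<bar>p - b\<bar>"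
        by linarith+
      have "U_fun \<alpha> (p + b) b + U_fun \<alpha> (p - b) b = ?e b"
        using U_outside[OF less_imp_le[OF that(1)] far(1)] U_outside[OF less_imp_le[OF that(1)] far(2)] by simp
      moreover have "b \<le> a" using that by (auto simp: d_def split: if_splits)
      ultimately show ?thesis
        using U_slice_antimono[of b a t p] that 3 by simp
    qed
    then have "\<forall>\<^sub>F b in at_right 0. ?g a \<le> ?e b"
      unfolding eventually_at_right_field using \<open>0 < d\<close> by blast
    moreover have "(?e \<longlongrightarrow> 2 * (c powr \<alpha> * 0 powr \<alpha>) - \<bar>p + 0\<bar> powr \<alpha> - \<bar>p - 0\<bar> powr \<alpha>) (at_right 0)"
      using \<alpha> by (intro tendsto_intros tendsto_powr') (auto intro: eventually_at_right_less eventually_mono)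
    ultimately have "?g a \<le> 2 * (c powr \<alpha> * 0 powr \<alpha>) - \<bar>p + 0\<bar> powr \<alpha> - \<bar>p - 0\<bar> powr \<alpha>"
      using tendsto_lowerbound[OF _ _ trivial_limit_at_right_real] by blast
    then show ?thesis
      using 3 by (simp add: U_fun_def)
  qed simp
qed

lemma U_node:
  assumes "0 \<le> t"
  shows "U_fun \<alpha> (p + a) (sqrt (t + a\<^sup>2)) + U_fun \<alpha> (p - a) (sqrt (t + a\<^sup>2)) \<le> 2 * U_fun \<alpha> p (sqrt t)"
  using U_node_nonneg[OF assms, of a p] U_node_nonneg[OF assms, of "- a" p] by (cases "0 \<le> a") auto

lemma attain_le_U:
  assumes "attain \<alpha> p r v" "0 \<le> r"
  shows "v \<le> U_fun \<alpha> p (sqrt r)"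
  using assms
proof induction
  case (leaf p r)
  then show ?case
    using obstacle_le_U[of "sqrt r" p] by (simp add: sqrt_powr)
next
  case (node p a r v w)
  then show ?case
    using U_node[of r p a] by simp
qed

subsection \<open>The candidate is minimal\<close>

text \<open>A supremum in the reals: leaves make the set nonempty, and for r \<ge> 0
  \<open>attain_le_U\<close> bounds it.\<close>

definition attain_sup :: "real \<Rightarrow> real \<Rightarrow> real" where
  "attain_sup p r = Sup {v. attain \<alpha> p r v}"

lemma attain_le_sup: "attain \<alpha> p r v \<Longrightarrow> 0 \<le> r \<Longrightarrow> v \<le> attain_sup p r"
  unfolding attain_sup_def using attain_le_U by (intro cSup_upper bdd_aboveI[of _ "U_fun \<alpha> p (sqrt r)"]) auto

lemma attain_sup_least: "(\<And>v. attain \<alpha> p r v \<Longrightarrow> v \<le> y) \<Longrightarrow> attain_sup p r \<le> y"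
  unfolding attain_sup_def by (rule cSup_least) (use attain.leaf in blast, simp)

lemma obstacle_le_attain_sup: "0 \<le> r \<Longrightarrow> c powr \<alpha> * r powr (\<alpha> / 2) - \<bar>p\<bar> powr \<alpha> \<le> attain_sup p r"
  by (rule attain_le_sup[OF attain.leaf])

lemma attain_sup_node:
  assumes "0 \<le> r"
  shows "attain_sup (p + a) (r + a\<^sup>2) + attain_sup (p - a) (r + a\<^sup>2) \<le> 2 * attain_sup p r"
proof -
  have "attain_sup (p - a) (r + a\<^sup>2) \<le> 2 * attain_sup p r - v" if v: "attain \<alpha> (p + a) (r + a\<^sup>2) v" for v
  proof (rule attain_sup_least)
    fix w assume "attain \<alpha> (p - a) (r + a\<^sup>2) w"
    from attain_le_sup[OF attain.node[OF v this] assms] show "w \<le> 2 * attain_sup p r - v" by simp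
  qed
  then have "attain_sup (p + a) (r + a\<^sup>2) \<le> 2 * attain_sup p r - attain_sup (p - a) (r + a\<^sup>2)"
    by (intro attain_sup_least) (simp add: algebra_simps)
  then show ?thesis by simp
qed

lemma attain_sup_scale:
  assumes "0 < l"
  shows "l powr \<alpha> * attain_sup p 1 \<le> attain_sup (l * p) (l\<^sup>2)"
proof -
  have "attain_sup p 1 \<le> attain_sup (l * p) (l\<^sup>2) / l powr \<alpha>"
  proof (rule attain_sup_least)
    fix v assume "attain \<alpha> p 1 v"
    from attain_le_sup[OF attain_scale[OF this assms]] show "v \<le> attain_sup (l * p) (l\<^sup>2) / l powr \<alpha>"
      using assms by (simp add: field_simps)
  qed
  with assms show ?thesis by (simp add: field_simps)
qed

text \<open>One splitting at r = 1, after which homogeneity brings both children back to r = 1. The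
  recursion thus concerns the single function \<open>attain_sup x 1\<close>.\<close>

lemma attain_sup_slice:
  defines "T \<equiv> \<lambda>a :: real. sqrt (1 + a\<^sup>2)"
  shows "T a powr \<alpha> * (attain_sup ((x + a) / T a) 1 + attain_sup ((x - a) / T a) 1) \<le> 2 * attain_sup x 1"
proof -
  have T: "0 < T a" "(T a)\<^sup>2 = 1 + a\<^sup>2"
    by (simp_all add: T_def add_pos_nonneg)
  have "T a powr \<alpha> * attain_sup (y / T a) 1 \<le> attain_sup y (1 + a\<^sup>2)" for y
    using attain_sup_scale[OF T(1), of "y / T a"] T by simp
  from this[of "x + a"] this[of "x - a"] attain_sup_node[of 1 x a] show ?thesis
    by (simp add: distrib_left)
qed

text \<open>For the profile w the factor in \<open>slice_derivative\<close> is z - y times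
  N''(\<xi>) + \<alpha> e minus the mean of N''(y) and N''(z). When y and z are close this exceeds
  \<alpha> e / 2, and integrating in the increment yields a gain quadratic in a and uniform in
  x.\<close>

lemma slice_strict_gain:
  fixes e :: real
  assumes "0 < e"
  defines "w \<equiv> \<lambda>x. Nfun \<alpha> x + e" and "T \<equiv> \<lambda>a :: real. sqrt (1 + a\<^sup>2)"
  obtains a0 where "0 < a0"
    "\<And>a x. 0 < a \<Longrightarrow> a \<le> a0 \<Longrightarrow> \<bar>x\<bar> \<le> 1 \<Longrightarrow>
      2 * w x + \<alpha> * e * a\<^sup>2 / 2 \<le> T a powr \<alpha> * (w ((x + a) / T a) + w ((x - a) / T a))"
proof -
  let ?n2 = "\<lambda>x. - \<alpha> * Nfun (\<alpha> - 2) x"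
  \<comment> \<open>All y and z below have absolute value at most 2, because |x| \<le> 1 and
    increments are at most 1.\<close>
  have "uniformly_continuous_on {-3..3} ?n2"
    by (intro compact_uniformly_continuous continuous_intros) auto
  moreover have "0 < \<alpha> * e / 2" using assms \<alpha> by simp
  ultimately obtain d where d: "0 < d"
    "\<And>x y. x \<in> {-3..3} \<Longrightarrow> y \<in> {-3..3} \<Longrightarrow> dist x y < d \<Longrightarrow> dist (?n2 x) (?n2 y) < \<alpha> * e / 2"
    unfolding uniformly_continuous_on_def by metis
  define a0 where "a0 = min 1 (d / 3)"
  have "0 < a0" "a0 \<le> 1" "2 * a0 < d" using d(1) by (auto simp: a0_def)
  have "2 * w x + \<alpha> * e * a\<^sup>2 / 2 \<le> T a powr \<alpha> * (w ((x + a) / T a) + w ((x - a) / T a))"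
    if a: "0 < a" "a \<le> a0" and x: "\<bar>x\<bar> \<le> 1" for a x
  proof -
    let ?h = "\<lambda>b. T b powr \<alpha> * (w ((x + b) / T b) + w ((x - b) / T b)) - \<alpha> * e / 2 * b\<^sup>2"
    have "?h 0 \<le> ?h a"
    proof (rule DERIV_nonneg_imp_nondecreasing[of 0 a ?h])
      fix b assume b: "0 \<le> b" "b \<le> a"
      define y z where "y = (x - b) / T b" and "z = (x + b) / T b"
      have T1: "1 \<le> T b" by (simp add: T_def)
      have zy: "z - y = 2 * b / T b" by (simp add: z_def y_def flip: diff_divide_distrib)
      have T2: "2 * b / T b \<le> 2 * b"
        using T1 b by (simp add: divide_le_eq mult_left_le mult_le_cancel_left1)
      have close: "y \<le> z" "z - y < d"
      proof -
        have "0 \<le> z - y" using b T1 unfolding zy by simp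
        then show "y \<le> z" by simp
        show "z - y < d" using b a \<open>2 * a0 < d\<close> T2 unfolding zy by linarith
      qed
      have small: "\<bar>v / T b\<bar> \<le> \<bar>v\<bar>" for v
        using T1 by (simp add: abs_divide divide_le_eq mult_le_cancel_left1)
      have yz: "\<bar>y\<bar> \<le> 2" "\<bar>z\<bar> \<le> 2"
        using small[of "x - b"] small[of "x + b"] b a x \<open>a0 \<le> 1\<close> unfolding y_def z_def by linarith+
      let ?G = "\<lambda>v. (\<alpha> * w v - v * deriv (Nfun \<alpha>) v) / 2"
      have G: "?G v = (\<alpha> * e - ?n2 v) / 2" for v
        using Nfun_ode[of \<alpha> v] by (simp add: w_def algebra_simps)
      have "\<alpha> * e / 2 * (z - y) \<le> deriv (Nfun \<alpha>) z - deriv (Nfun \<alpha>) y + (z - y) * (?G z + ?G y)"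
      proof (cases "y = z")
        case False
        with close have "y < z" by simp
        then obtain \<xi> where \<xi>: "y < \<xi>" "\<xi> < z" "deriv (Nfun \<alpha>) z - deriv (Nfun \<alpha>) y = (z - y) * ?n2 \<xi>"
          using MVT2[OF _ has_derivative_deriv_Nfun[of \<alpha>]] by metis
        then have "dist (?n2 \<xi>) (?n2 z) < \<alpha> * e / 2" "dist (?n2 \<xi>) (?n2 y) < \<alpha> * e / 2"
          using yz close by (intro d(2); simp add: dist_real_def abs_le_iff)+
        \<comment> \<open>Used with h = \<alpha> e, with u the value of N'' at \<xi>, and with v, v'
          its values at z and y.\<close>
        moreover have "h / 2 \<le> u + ((h - v) / 2 + (h - v') / 2)"
          if "dist u v < h / 2" "dist u v' < h / 2" for h u v v' :: real
        proof -
          have "- (h / 2) < u - v" "- (h / 2) < u - v'"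
            using that unfolding dist_real_def by linarith+
          then show ?thesis by (simp add: field_simps)
        qed
        ultimately have "\<alpha> * e / 2 \<le> ?n2 \<xi> + (?G z + ?G y)"
          unfolding G by blast
        then have "(z - y) * (\<alpha> * e / 2) \<le> (z - y) * (?n2 \<xi> + (?G z + ?G y))"
          using close by (intro mult_left_mono) auto
        then show ?thesis
          unfolding \<xi>(3) by (simp only: distrib_left mult.commute)
      qed simp
      then have "T b powr (\<alpha> - 1) * (\<alpha> * e / 2 * (z - y)) \<le>
          T b powr (\<alpha> - 1) * (deriv (Nfun \<alpha>) z - deriv (Nfun \<alpha>) y + (z - y) * (?G z + ?G y))"
        by (intro mult_left_mono) auto
      moreover have "\<alpha> * e * b \<le> T b powr (\<alpha> - 1) * (\<alpha> * e / 2 * (z - y))"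
      proof -
        have "T b powr (\<alpha> - 1) * (\<alpha> * e / 2 * (z - y)) = T b powr (\<alpha> - 2) * (\<alpha> * e * b)"
          using T1 by (simp add: zy powr_diff power2_eq_square)
        moreover have "1 \<le> T b powr (\<alpha> - 2)"
          using T1 \<alpha> by (simp add: ge_one_powr_ge_zero)
        then have "1 * (\<alpha> * e * b) \<le> T b powr (\<alpha> - 2) * (\<alpha> * e * b)"
          using \<alpha> assms b by (intro mult_right_mono) auto
        ultimately show ?thesis by (simp only: mult_1)
      qed
      ultimately have "0 \<le> T b powr (\<alpha> - 1) *
          (deriv (Nfun \<alpha>) z - deriv (Nfun \<alpha>) y + (z - y) * (?G z + ?G y)) - \<alpha> * e / 2 * (2 * b)"
        by simp
      moreover have "(?h has_real_derivative T b powr (\<alpha> - 1) *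
          (deriv (Nfun \<alpha>) z - deriv (Nfun \<alpha>) y + (z - y) * (?G z + ?G y)) - \<alpha> * e / 2 * (2 * b)) (at b)"
      proof (rule DERIV_diff)
        have w': "(w has_real_derivative deriv (Nfun \<alpha>) v) (at v)" for v
          unfolding w_def using DERIV_add[OF has_derivative_Nfun DERIV_const] by simp
        have pos: "0 < 1 + b\<^sup>2" by (simp add: add_pos_nonneg)
        show "((\<lambda>b. T b powr \<alpha> * (w ((x + b) / T b) + w ((x - b) / T b))) has_real_derivative
            T b powr (\<alpha> - 1) * (deriv (Nfun \<alpha>) z - deriv (Nfun \<alpha>) y + (z - y) * (?G z + ?G y))) (at b)"
          using slice_derivative[OF w' pos, of \<alpha> x] by (simp only: T_def z_def y_def add_divide_distrib)
        show "((\<lambda>b. \<alpha> * e / 2 * b\<^sup>2) has_real_derivative \<alpha> * e / 2 * (2 * b)) (at b)"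
          by (rule derivative_eq_intros refl | simp)+
      qed
      ultimately show "\<exists>D. (?h has_real_derivative D) (at b) \<and> 0 \<le> D"
        by blast
    qed (use a in simp)
    then show ?thesis by (simp add: T_def)
  qed
  with \<open>0 < a0\<close> show ?thesis by (rule that)
qed

text \<open>A minimum principle. If the infimum of \<open>attain_sup x 1 / w x\<close> over [-s, s]
  were at most k, the strict gain would raise it above itself; beyond s the obstacle alone already
  dominates k w.\<close>

lemma attain_sup_ge_subsolution:
  assumes s: "0 < s" "s < c" and e: "0 < e" and k: "0 < k" "k * (Nfun \<alpha> s + e) < c powr \<alpha> - s powr \<alpha>"
    and x: "\<bar>x\<bar> \<le> s"
  shows "k * (Nfun \<alpha> x + e) \<le> attain_sup x 1"
proof -
  define w where "w x = Nfun \<alpha> x + e" for x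
  define T where "T a = sqrt (1 + a\<^sup>2)" for a :: real
  have w_even: "w \<bar>x\<bar> = w x" for x by (simp add: w_def abs_if Nfun_minus)
  have w: "0 < w x" "w x \<le> 1 + e" if "\<bar>x\<bar> \<le> c" for x
  proof -
    show "0 < w x" using Nfun_nonneg[of \<alpha> x] that e by (simp add: w_def)
    have "Nfun \<alpha> \<bar>x\<bar> \<le> Nfun \<alpha> 0" using that \<alpha> by (intro Nfun_antimono) auto
    then have "w \<bar>x\<bar> \<le> 1 + e" by (simp add: w_def Nfun_0)
    then show "w x \<le> 1 + e" by (simp add: w_even)
  qed
  have obst: "c powr \<alpha> - \<bar>x\<bar> powr \<alpha> \<le> attain_sup x 1" for x
    using obstacle_le_attain_sup[of 1 x] by simp
  obtain a0 where a0: "0 < a0"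
    "\<And>a x. 0 < a \<Longrightarrow> a \<le> a0 \<Longrightarrow> \<bar>x\<bar> \<le> 1 \<Longrightarrow>
      2 * w x + \<alpha> * e * a\<^sup>2 / 2 \<le> T a powr \<alpha> * (w ((x + a) / T a) + w ((x - a) / T a))"
    using slice_strict_gain[OF e] unfolding w_def T_def by metis
  have "((\<lambda>y. c powr \<alpha> - y powr \<alpha> - k * w y) has_real_derivative
      0 - \<alpha> * s powr (\<alpha> - 1) - k * (deriv (Nfun \<alpha>) s + 0)) (at s)"
    unfolding w_def
    by (intro DERIV_diff DERIV_const has_real_derivative_powr s DERIV_cmult DERIV_add has_derivative_Nfun)
  then have "isCont (\<lambda>y. c powr \<alpha> - y powr \<alpha> - k * w y) s"
    by (rule DERIV_isCont)
  then have "((\<lambda>y. c powr \<alpha> - y powr \<alpha> - k * w y) \<longlongrightarrow> c powr \<alpha> - s powr \<alpha> - k * w s) (at s)"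
    by (rule isContD)
  moreover have "0 < c powr \<alpha> - s powr \<alpha> - k * w s" using k by (simp add: w_def)
  ultimately have "\<forall>\<^sub>F y in at s. 0 < c powr \<alpha> - y powr \<alpha> - k * w y"
    by (rule order_tendstoD)
  then obtain a1 where a1: "0 < a1" "\<And>y. y \<noteq> s \<Longrightarrow> dist y s < a1 \<Longrightarrow> k * w y < c powr \<alpha> - y powr \<alpha>"
    unfolding eventually_at by force
  \<comment> \<open>The three bounds make the strict gain available, keep s + a where the obstacle
    exceeds k w, and keep s + a \<le> c, where w is positive.\<close>
  define a where "a = Min {a0, a1 / 2, c - s}"
  have a: "0 < a" "a \<le> a0" "a < a1" "s + a \<le> c"
    using a0(1) a1(1) s by (auto simp: a_def)
  define m where "m = Inf ((\<lambda>x. attain_sup x 1 / w x) ` {-s..s})"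
  have w_s: "0 < w x" "w x \<le> 1 + e" if "\<bar>x\<bar> \<le> s" for x
    using w[of x] that s by auto
  \<comment> \<open>The obstacle gives this positive lower bound for the quotient, so the infimum m
    exists and is positive.\<close>
  define m0 where "m0 = (c powr \<alpha> - s powr \<alpha>) / (1 + e)"
  have "0 < m0"
    using s \<alpha> e powr_less_mono2[of \<alpha> s c] by (simp add: m0_def)
  have lower: "m0 \<le> attain_sup x 1 / w x" if "\<bar>x\<bar> \<le> s" for x
  proof -
    have "s powr \<alpha> < c powr \<alpha>" "\<bar>x\<bar> powr \<alpha> \<le> s powr \<alpha>"
      using s \<alpha> that by (auto intro: powr_less_mono2 powr_mono2)
    then have "m0 \<le> (c powr \<alpha> - s powr \<alpha>) / w x"
      using w_s[OF that] e unfolding m0_def by (intro divide_left_mono) auto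
    also have "\<dots> \<le> attain_sup x 1 / w x"
      using obst[of x] \<open>\<bar>x\<bar> powr \<alpha> \<le> s powr \<alpha>\<close> w_s[OF that] by (intro divide_right_mono) auto
    finally show ?thesis .
  qed
  have m_le: "m \<le> attain_sup x 1 / w x" if "\<bar>x\<bar> \<le> s" for x
    unfolding m_def using that lower by (intro cInf_lower image_eqI[OF refl] bdd_belowI[of _ m0]) auto
  have m_ge: "y \<le> m" if "\<And>x. \<bar>x\<bar> \<le> s \<Longrightarrow> y \<le> attain_sup x 1 / w x" for y
    unfolding m_def using that s by (intro cInf_greatest) auto
  \<comment> \<open>The part n \<le> m serves on [-s, s] and n \<le> k on the collar up to s + a.
    Both children of a point of [-s, s] stay in this larger interval because T a \<ge> 1.\<close>
  define n where "n = min m k"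
  have n: "0 < n" "n \<le> m" "n \<le> k"
    using m_ge[of m0] lower \<open>0 < m0\<close> k by (auto simp: n_def)
  have near: "n * w x \<le> attain_sup x 1" if x: "\<bar>x\<bar> \<le> s + a" for x
  proof (cases "\<bar>x\<bar> \<le> s")
    case True
    then have "n \<le> attain_sup x 1 / w x" using m_le n by force
    then show ?thesis using w_s[OF True] by (simp add: field_simps)
  next
    case False
    have "n * w x \<le> k * w x" using n w[of x] x a by (intro mult_right_mono) auto
    also have "k * w x = k * w \<bar>x\<bar>" by (simp add: w_even)
    also have "\<dots> \<le> c powr \<alpha> - \<bar>x\<bar> powr \<alpha>"
      using False x a by (intro less_imp_le a1(2)) (auto simp: dist_real_def)
    also have "\<dots> \<le> attain_sup x 1" by (rule obst)
    finally show ?thesis .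
  qed
  define g where "g = \<alpha> * e * a\<^sup>2 / 4"
  have "0 < g" using \<alpha> e a by (simp add: g_def)
  have gain: "n + n * g / (1 + e) \<le> attain_sup x 1 / w x" if x: "\<bar>x\<bar> \<le> s" for x
  proof -
    have T: "1 \<le> T a" by (simp add: T_def)
    have small: "\<bar>v / T a\<bar> \<le> \<bar>v\<bar>" for v
      using T by (simp add: abs_divide divide_le_eq mult_le_cancel_left1)
    have "n * (2 * w x + 2 * g) \<le> n * (T a powr \<alpha> * (w ((x + a) / T a) + w ((x - a) / T a)))"
      using a0(2)[OF a(1,2), of x] n x s c_zero(2) by (intro mult_left_mono) (auto simp: g_def)
    also have "\<dots> = T a powr \<alpha> * (n * w ((x + a) / T a) + n * w ((x - a) / T a))"
      by (simp add: algebra_simps)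
    also have "\<dots> \<le> T a powr \<alpha> * (attain_sup ((x + a) / T a) 1 + attain_sup ((x - a) / T a) 1)"
      using small[of "x + a"] small[of "x - a"] x a by (intro mult_left_mono add_mono near) auto
    also have "\<dots> \<le> 2 * attain_sup x 1"
      unfolding T_def by (rule attain_sup_slice)
    finally have "n * w x + n * g \<le> attain_sup x 1" by (simp add: algebra_simps)
    then have "(n * w x + n * g) / w x \<le> attain_sup x 1 / w x"
      using w_s[OF x] by (intro divide_right_mono) auto
    moreover have "(n * w x + n * g) / w x = n + n * g / w x"
      using w_s[OF x] by (simp add: add_divide_distrib)
    moreover have "n * g / (1 + e) \<le> n * g / w x"
      using w_s[OF x] n \<open>0 < g\<close> by (intro divide_left_mono) auto
    ultimately show ?thesis by linarith
  qed
  then have "n + n * g / (1 + e) \<le> m" by (rule m_ge)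
  moreover have "0 < n * g / (1 + e)" using n \<open>0 < g\<close> e by simp
  \<comment> \<open>The gain shows n < m, so the minimum is attained by k.\<close>
  ultimately have "n = k" by (simp add: n_def)
  with near[of x] x a show ?thesis by (simp add: w_def)
qed

text \<open>If the claim failed, it would fail for some k < \<kappa>. For such k the obstacle minus
  k N_\<alpha> vanishes at c with negative slope, hence is positive at some s just left of c, and
  the minimum principle applies on [-s, s].\<close>

lemma attain_sup_ge_inside:
  assumes "\<bar>x\<bar> < c"
  shows "\<kappa> * Nfun \<alpha> x \<le> attain_sup x 1"
proof (rule ccontr)
  assume neg: "\<not> ?thesis"
  have Nx: "0 < Nfun \<alpha> x"
    using c_zero(4)[of "\<bar>x\<bar>"] assms Nfun_minus[of \<alpha> x] by (simp add: abs_if split: if_splits)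
  \<comment> \<open>The entry \<kappa> / 2 only keeps k positive.\<close>
  define k where "k = max (\<kappa> / 2) (attain_sup x 1 / Nfun \<alpha> x)"
  have k: "0 < k" "k < \<kappa>" "attain_sup x 1 \<le> k * Nfun \<alpha> x"
    using neg Nx \<kappa>_pos by (auto simp: k_def max_def field_simps)
  let ?f = "\<lambda>y. c powr \<alpha> - y powr \<alpha> - k * Nfun \<alpha> y"
  have "(?f has_real_derivative 0 - \<alpha> * c powr (\<alpha> - 1) - k * deriv (Nfun \<alpha>) c) (at c)"
    using c_zero(1) by (intro DERIV_diff DERIV_const has_real_derivative_powr DERIV_cmult has_derivative_Nfun)
  moreover have "0 - \<alpha> * c powr (\<alpha> - 1) - k * deriv (Nfun \<alpha>) c = (\<kappa> - k) * deriv (Nfun \<alpha>) c"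
    using \<kappa>_deriv by (simp add: algebra_simps)
  ultimately have der: "(?f has_real_derivative (\<kappa> - k) * deriv (Nfun \<alpha>) c) (at c)"
    by simp
  have "(\<kappa> - k) * deriv (Nfun \<alpha>) c < 0"
    using k deriv_Nfun_c_neg by (intro mult_pos_neg) auto
  from DERIV_neg_dec_left[OF der this]
  obtain d where d: "0 < d" "\<And>h. 0 < h \<Longrightarrow> h < d \<Longrightarrow> ?f c < ?f (c - h)"
    by blast
  define h where "h = min (d / 2) ((c - \<bar>x\<bar>) / 2)"
  define s where "s = c - h"
  have h: "0 < h" "h < d" "h < c - \<bar>x\<bar>"
    using d(1) assms by (auto simp: h_def min_less_iff_disj)
  then have s: "0 < s" "s < c" "\<bar>x\<bar> \<le> s" by (auto simp: s_def)
  define g where "g = c powr \<alpha> - s powr \<alpha> - k * Nfun \<alpha> s"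
  have g: "0 < g" using d(2)[OF h(1,2)] by (simp add: g_def s_def c_zero(3))
  \<comment> \<open>The choice e = g / (2 k) spends half of the gap g, so the comparison at s stays
    strict.\<close>
  have "k * (Nfun \<alpha> s + g / (2 * k)) < c powr \<alpha> - s powr \<alpha>"
    using g k by (simp add: distrib_left) (simp add: g_def field_simps)
  then have "k * (Nfun \<alpha> x + g / (2 * k)) \<le> attain_sup x 1"
    using s g k by (intro attain_sup_ge_subsolution) auto
  moreover have "0 < k * (g / (2 * k))" using g k by simp
  ultimately show False using k(3) by (simp add: distrib_left)
qed

lemma U_le_attain_sup: "0 \<le> q \<Longrightarrow> U_fun \<alpha> p q \<le> attain_sup p (q\<^sup>2)"
proof (cases "c * q \<le> \<bar>p\<bar>")
  case True
  assume "0 \<le> q"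
  moreover have "q\<^sup>2 powr (\<alpha> / 2) = q powr \<alpha>"
    using sqrt_powr[of "q\<^sup>2" \<alpha>] \<open>0 \<le> q\<close> by simp
  ultimately show ?thesis
    using obstacle_le_attain_sup[of "q\<^sup>2" p] U_outside[of q p] True by simp
next
  case False
  assume "0 \<le> q"
  with False have "0 < q" by (cases "q = 0") auto
  with False have q: "0 < q" "\<bar>p / q\<bar> < c"
    by (simp_all add: abs_divide pos_divide_less_eq)
  then have "U_fun \<alpha> p q = q powr \<alpha> * (\<kappa> * Nfun \<alpha> (p / q))"
    by (simp add: U_pos u_inside)
  also have "\<dots> \<le> q powr \<alpha> * attain_sup (p / q) 1"
    using attain_sup_ge_inside[OF q(2)] by (intro mult_left_mono) auto
  also have "\<dots> \<le> attain_sup p (q\<^sup>2)"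
    using attain_sup_scale[OF q(1), of "p / q"] q by simp
  finally show ?thesis .
qed

lemma SUP_attain: "(SUP v \<in> {v. attain \<alpha> p (q\<^sup>2) v}. ereal v) = ereal (U_fun \<alpha> p q)"
proof -
  have U: "U_fun \<alpha> p q = U_fun \<alpha> p \<bar>q\<bar>" by (simp add: U_fun_def)
  have "attain_sup p (q\<^sup>2) = U_fun \<alpha> p q"
  proof (rule antisym)
    show "attain_sup p (q\<^sup>2) \<le> U_fun \<alpha> p q"
      using attain_le_U[of p "q\<^sup>2"] by (intro attain_sup_least) (simp add: U)
    show "U_fun \<alpha> p q \<le> attain_sup p (q\<^sup>2)"
      using U_le_attain_sup[of "\<bar>q\<bar>" p] by (simp add: U)
  qed
  show ?thesis
  proof (rule antisym)
    show "(SUP v \<in> {v. attain \<alpha> p (q\<^sup>2) v}. ereal v) \<le> ereal (U_fun \<alpha> p q)"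
      using attain_le_sup[of p "q\<^sup>2"] by (intro SUP_least) (simp add: \<open>attain_sup p (q\<^sup>2) = _\<close>)
    show "ereal (U_fun \<alpha> p q) \<le> (SUP v \<in> {v. attain \<alpha> p (q\<^sup>2) v}. ereal v)"
    \<comment> \<open>It suffices to test real upper bounds z of the extended supremum; each of them
      bounds the real supremum \<open>attain_sup\<close>.\<close>
    proof (rule ereal_le_real)
      fix z assume z: "(SUP v \<in> {v. attain \<alpha> p (q\<^sup>2) v}. ereal v) \<le> ereal z"
      have "v \<le> z" if "attain \<alpha> p (q\<^sup>2) v" for v
        using SUP_upper[of v "{v. attain \<alpha> p (q\<^sup>2) v}" ereal] that z
        by (metis ereal_less_eq(3) mem_Collect_eq order_trans)
      then have "attain_sup p (q\<^sup>2) \<le> z" by (rule attain_sup_least)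
      then show "ereal (U_fun \<alpha> p q) \<le> ereal z" by (simp add: \<open>attain_sup p (q\<^sup>2) = _\<close>)
    qed
  qed
qed

end

theorem theorem1p8:
  fixes \<alpha> :: real and I :: "real set" and p q :: real
  assumes "2 \<le> \<alpha>"
    and "is_interval I" and "bounded I" and "interior I \<noteq> {}"
  shows "bellman \<alpha> I p q = ereal (U_fun \<alpha> p q)"
proof -
  interpret square_exponent \<alpha> by unfold_locales fact
  show ?thesis
    using bellman_attain[OF bounded_interval_spans[OF assms(2-4)]] SUP_attain by simp
qed

end
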